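(* For all positive integers $r,c$, as formal power series in $s$ with coefficients in $\mathbb{Z}[t]$, $$ \sum_{\pi \in \mathcal{P}(r,c)}A_\pi(t)\,s^{|\pi|}= \prod_{i=1}^{r}\prod_{j=1}^{c} \frac{1-ts^{i+j-1}}{1-s^{i+j-1}}. $$ In particular, $$ \sum_{\pi \in \mathcal{P}}A_\pi(t)\,s^{|\pi|}= \prod_{n=1}^{\infty} \left(\frac{1-ts^n}{1-s^{n}}\right)^n. $$
   Context: A plane partition is an array $\pi=(\pi(i,j))_{i,j\ge 1}$ of nonnegative integers, only finitely many nonzero, nonincreasing along each row and each column; its support is the set of boxes $(i,j)$ with $\pi(i,j)>0$, and $|\pi|=\sum_{i,j}\pi(i,j)$. $\mathcal{P}$ is the set of all plane partitions and $\mathcal{P}(r,c)$ the set of those with $\pi(i,j)=0$ whenever $i>r$ or $j>c$. A connected component of $\pi$ is a maximal set of boxes of the support, connected through boxes sharing an edge, all filled with the same number. If a box $(i,j)$ lies in a connected component $C$, its level is the smallest positive integer $h$ such that $(i+h,j+h)\notin C$. A border component is a maximal edge-connected subset of a connected component all of whose boxes have the same level; its level is that common level. For a connected component $C$ let $n_i$ be the number of border components of $C$ of level $i$, and $P_C(t)=\prod_{i\ge1}(1-t^i)^{n_i}$. Then $A_\pi(t)=\prod_C P_C(t)$, the product over all connected components $C$ of $\pi$. *)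

theory Defs
  imports "HOL-Analysis.Analysis"
begin

type_synonym box = "nat \<times> nat"

text \<open>Arrays are indexed by positive integers; the value \<open>0\<close> is imposed at the junk indices
  \<open>i = 0\<close> or \<open>j = 0\<close>, so that distinct functions are distinct plane partitions.\<close>

definition support :: "(nat \<Rightarrow> nat \<Rightarrow> nat) \<Rightarrow> box set" where
  "support \<pi> = {(i, j). 1 \<le> i \<and> 1 \<le> j \<and> \<pi> i j > 0}"

definition plane_partitions :: "(nat \<Rightarrow> nat \<Rightarrow> nat) set" where
  "plane_partitions = {\<pi>.
     (\<forall>i j. i = 0 \<or> j = 0 \<longrightarrow> \<pi> i j = 0) \<and>
     finite (support \<pi>) \<and>
     (\<forall>i\<ge>1. \<forall>j\<ge>1. \<pi> i (j + 1) \<le> \<pi> i j) \<and>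
     (\<forall>i\<ge>1. \<forall>j\<ge>1. \<pi> (i + 1) j \<le> \<pi> i j)}"

definition plane_partitions_in :: "nat \<Rightarrow> nat \<Rightarrow> (nat \<Rightarrow> nat \<Rightarrow> nat) set" where
  "plane_partitions_in r c = {\<pi> \<in> plane_partitions. \<forall>i j. i > r \<or> j > c \<longrightarrow> \<pi> i j = 0}"

definition pp_size :: "(nat \<Rightarrow> nat \<Rightarrow> nat) \<Rightarrow> nat" where
  "pp_size \<pi> = (\<Sum>(i, j)\<in>support \<pi>. \<pi> i j)"

fun share_edge :: "box \<Rightarrow> box \<Rightarrow> bool" where
  "share_edge (i, j) (i', j') \<longleftrightarrow>
     (i = i' \<and> (j' = j + 1 \<or> j = j' + 1)) \<or> (j = j' \<and> (i' = i + 1 \<or> i = i' + 1))"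

definition edge_connected :: "box set \<Rightarrow> bool" where
  "edge_connected S \<longleftrightarrow>
     (\<forall>x\<in>S. \<forall>y\<in>S. (\<lambda>a b. a \<in> S \<and> b \<in> S \<and> share_edge a b)\<^sup>*\<^sup>* x y)"

definition uniform_connected :: "(box \<Rightarrow> nat) \<Rightarrow> box set \<Rightarrow> bool" where
  "uniform_connected f S \<longleftrightarrow> S \<noteq> {} \<and> edge_connected S \<and> (\<forall>x\<in>S. \<forall>y\<in>S. f x = f y)"

definition maximal_uniform_connected :: "(box \<Rightarrow> nat) \<Rightarrow> box set \<Rightarrow> box set set" where
  "maximal_uniform_connected f S =
     {C. C \<subseteq> S \<and> uniform_connected f C \<and>
         (\<forall>D. C \<subseteq> D \<and> D \<subseteq> S \<and> uniform_connected f D \<longrightarrow> D = C)}"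

definition connected_components_pp :: "(nat \<Rightarrow> nat \<Rightarrow> nat) \<Rightarrow> box set set" where
  "connected_components_pp \<pi> = maximal_uniform_connected (\<lambda>(i, j). \<pi> i j) (support \<pi>)"

definition level :: "box set \<Rightarrow> box \<Rightarrow> nat" where
  "level C = (\<lambda>(i, j). LEAST h. 0 < h \<and> (i + h, j + h) \<notin> C)"

definition border_components :: "box set \<Rightarrow> box set set" where
  "border_components C = maximal_uniform_connected (level C) C"

definition num_border_components :: "box set \<Rightarrow> nat \<Rightarrow> nat" where
  "num_border_components C i = card {B \<in> border_components C. \<forall>b\<in>B. level C b = i}"

definition tvar :: "int poly" where
  "tvar = [:0, 1:]"

text \<open>The product over all \<open>i \<ge> 1\<close> is restricted to those \<open>i\<close> with a nonzero exponent;
  this set is finite for finite \<open>C\<close> (lemma \<open>finite_border_levels\<close> below).\<close>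

definition component_poly :: "box set \<Rightarrow> int poly" where
  "component_poly C =
     (\<Prod>i | 1 \<le> i \<and> num_border_components C i \<noteq> 0.
        (1 - tvar ^ i) ^ num_border_components C i)"

definition pp_weight :: "(nat \<Rightarrow> nat \<Rightarrow> nat) \<Rightarrow> int poly" where
  "pp_weight \<pi> = (\<Prod>C\<in>connected_components_pp \<pi>. component_poly C)"

text \<open>The power series \<open>(1 - t s^k) / (1 - s^k)\<close> over \<open>\<int>[t]\<close>, where \<open>s\<close> is \<open>fps_X\<close>. The type
  \<open>int poly\<close> is not in class \<open>inverse\<close>, so division on \<open>int poly fps\<close> is unavailable;
  \<open>fps_left_inverse f 1\<close> is the inverse of a series \<open>f\<close> with constant term \<open>1\<close>.\<close>

definition macmahon_factor :: "nat \<Rightarrow> int poly fps" where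
  "macmahon_factor k =
     (1 - fps_const tvar * fps_X ^ k) * fps_left_inverse (1 - fps_X ^ k) 1"

lemma macmahon_factor_mult:
  assumes "k \<ge> 1"
  shows "macmahon_factor k * (1 - fps_X ^ k) = 1 - fps_const tvar * fps_X ^ k"
proof -
  have "fps_left_inverse (1 - fps_X ^ k) 1 * (1 - fps_X ^ k) = (1 :: int poly fps)"
    by (rule fps_left_inverse) (use assms in simp)
  then show ?thesis
    unfolding macmahon_factor_def by (simp add: mult.assoc)
qed

lemma finite_maximal_uniform_connected:
  assumes "finite S"
  shows "finite (maximal_uniform_connected f S)"
  by (rule finite_subset[of _ "Pow S"]) (use assms in \<open>auto simp: maximal_uniform_connected_def\<close>)

lemma finite_connected_components_pp:
  assumes "\<pi> \<in> plane_partitions"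
  shows "finite (connected_components_pp \<pi>)"
  using assms
  by (simp add: connected_components_pp_def finite_maximal_uniform_connected plane_partitions_def)

lemma finite_border_levels:
  assumes "finite C"
  shows "finite {i. 1 \<le> i \<and> num_border_components C i \<noteq> 0}"
proof (rule finite_subset)
  show "finite (level C ` C)"
    using assms by simp
  show "{i. 1 \<le> i \<and> num_border_components C i \<noteq> 0} \<subseteq> level C ` C"
  proof
    fix i assume "i \<in> {i. 1 \<le> i \<and> num_border_components C i \<noteq> 0}"
    then have "{B \<in> border_components C. \<forall>b\<in>B. level C b = i} \<noteq> {}"
      unfolding num_border_components_def by (intro notI) simp
    then obtain B where B: "B \<in> border_components C" "\<forall>b\<in>B. level C b = i"
      by blast
    then have "B \<noteq> {}" "B \<subseteq> C"
      by (auto simp: border_components_def maximal_uniform_connected_def uniform_connected_def)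
    then obtain b where "b \<in> B" "b \<in> C"
      by blast
    with B show "i \<in> level C ` C"
      by (intro image_eqI[of _ _ b]) simp_all
  qed
qed

end

theory Submission
  imports Defs
begin

text \<open>
  Cut a plane partition \<open>\<pi>\<close> into its diagonals \<open>\<lambda>(d)\<close>, and describe each of them by its column lengths
  \<open>v \<mapsto> |{boxes of the diagonal with entry > v}|\<close>. Neighbouring diagonals interlace, i.e. the column
  lengths change by \<open>0\<close> or \<open>1\<close> (upwards left of the main diagonal, downwards right of it). Every diagonal
  that contains \<open>v\<close> at least \<open>h\<close> times has exactly one box of value \<open>v\<close> and level \<open>h\<close>, and on neighbouring
  diagonals these boxes share an edge. So border components are maximal runs of such
  diagonals, and \<open>A\<^sub>\<pi>(t)\<close> is a product, over the steps \<open>\<lambda>(d) \<rightarrow> \<lambda>(d+1)\<close> and the values \<open>v\<close> whose multiplicity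
  \<open>m\<close> goes up in the step, of \<open>1 - t^m\<close> (with \<open>m\<close> the new multiplicity). These are the branching
  coefficients of Hall-Littlewood functions.

  For them, an up step followed by a down step commutes with a down step followed by an up step up to
  the factor \<open>(1 - t x y) / (1 - x y)\<close> (the one-variable skew Cauchy identity), where \<open>x\<close> and \<open>y\<close> mark the
  sizes of the steps. This is proved with a two-state transfer matrix that scans the columns. With
  \<open>x\<^sub>i = s^i\<close>, \<open>y\<^sub>j = s^(j-1)\<close> the size of \<open>\<pi>\<close> is recorded, and moving all down steps in front of all up
  steps leaves only the constant chain and the product over the \<open>r \<times> c\<close> rectangle. All sums are kept
  finite by allowing only \<open>N\<close> columns and computing modulo \<open>s^(N+1)\<close>.
\<close>

section \<open>The skew Cauchy identity for one up step and one down step\<close>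

text \<open>\<open>m\<close> and \<open>m'\<close> are the multiplicities of a part before and after a step. Negative \<open>m'\<close> gives \<open>1 - t^0 = 0\<close>
  or \<open>1\<close>; it only arises in transfer paths that are not antitone, whose total weight vanishes.\<close>

definition hl_factor :: "'a::comm_ring_1 \<Rightarrow> int \<Rightarrow> int \<Rightarrow> 'a" where
  "hl_factor t m m' = (if m < m' then 1 - t ^ nat m' else 1)"

section \<open>Transfer vectors as sums over state paths\<close>

fun transfer_vec :: "(nat \<Rightarrow> int set) \<Rightarrow> (nat \<Rightarrow> int \<Rightarrow> int \<Rightarrow> 'a::comm_ring_1) \<Rightarrow> (nat \<Rightarrow> int \<Rightarrow> 'a)
    \<Rightarrow> nat \<Rightarrow> int \<Rightarrow> 'a" where
  "transfer_vec S T g 0 q = g 0 q"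
| "transfer_vec S T g (Suc k) q = (\<Sum>p\<in>S k. transfer_vec S T g k p * T k p q) * g (Suc k) q"

definition state_paths :: "(nat \<Rightarrow> int set) \<Rightarrow> nat \<Rightarrow> (nat \<Rightarrow> int) set" where
  "state_paths S k = {f. (\<forall>v<k. f v \<in> S v) \<and> (\<forall>v\<ge>k. f v = 0)}"

lemma state_paths_0: "state_paths S 0 = {\<lambda>_. 0}"
  by (auto simp: state_paths_def)

lemma bij_betw_state_paths_Suc:
  "bij_betw (\<lambda>(f, p). f(k := p)) (state_paths S k \<times> S k) (state_paths S (Suc k))"
proof (rule bij_betw_byWitness[where f' = "\<lambda>f. (f(k := 0), f k)"])
  show "\<forall>a\<in>state_paths S k \<times> S k. (\<lambda>f. (f(k := 0), f k)) ((\<lambda>(f, p). f(k := p)) a) = a"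
    by (auto simp: state_paths_def)
  show "\<forall>f\<in>state_paths S (Suc k). (\<lambda>(f, p). f(k := p)) (f(k := 0), f k) = f"
    by auto
  show "(\<lambda>(f, p). f(k := p)) ` (state_paths S k \<times> S k) \<subseteq> state_paths S (Suc k)"
    by (auto simp: state_paths_def less_Suc_eq)
  show "(\<lambda>f. (f(k := 0), f k)) ` state_paths S (Suc k) \<subseteq> state_paths S k \<times> S k"
    by (auto simp: state_paths_def)
qed

lemma finite_state_paths: "(\<And>v. finite (S v)) \<Longrightarrow> finite (state_paths S k)"
proof (induction k)
  case 0
  then show ?case by (simp add: state_paths_0)
next
  case (Suc k)
  then show ?case
    using bij_betw_finite[OF bij_betw_state_paths_Suc[of k S]] by simp
qed

text \<open>Unrolling the recursion expands the matrix product into a sum over paths; the update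
  \<open>f(k := q)\<close> only supplies the final state to the last transition.\<close>

lemma transfer_vec_eq_sum:
  fixes T :: "nat \<Rightarrow> int \<Rightarrow> int \<Rightarrow> 'a::comm_ring_1"
  shows "transfer_vec S T g k q =
    (\<Sum>f\<in>state_paths S k. (\<Prod>v<k. T v (f v) ((f(k := q)) (Suc v))) * (\<Prod>v<k. g v (f v)) * g k q)"
proof (induction k arbitrary: q)
  case 0
  then show ?case by (simp add: state_paths_0)
next
  case (Suc k)
  have "(\<Sum>f\<in>state_paths S (Suc k). (\<Prod>v<Suc k. T v (f v) ((f(Suc k := q)) (Suc v))) *
          (\<Prod>v<Suc k. g v (f v)) * g (Suc k) q) =
        (\<Sum>(f,p)\<in>state_paths S k \<times> S k.
          (\<Prod>v<Suc k. T v ((f(k := p)) v) ((f(k := p, Suc k := q)) (Suc v))) *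
          (\<Prod>v<Suc k. g v ((f(k := p)) v)) * g (Suc k) q)"
    by (subst sum.reindex_bij_betw[OF bij_betw_state_paths_Suc, symmetric])
      (simp add: case_prod_unfold)
  also have "\<dots> = (\<Sum>p\<in>S k. \<Sum>f\<in>state_paths S k.
          (\<Prod>v<Suc k. T v ((f(k := p)) v) ((f(k := p, Suc k := q)) (Suc v))) *
          (\<Prod>v<Suc k. g v ((f(k := p)) v)) * g (Suc k) q)"
    by (subst sum.cartesian_product[symmetric], subst sum.swap) simp
  also have "\<dots> = (\<Sum>p\<in>S k. \<Sum>f\<in>state_paths S k.
          ((\<Prod>v<k. T v (f v) ((f(k := p)) (Suc v))) * (\<Prod>v<k. g v (f v)) * g k p) * T k p q * g (Suc k) q)"
  proof (intro sum.cong refl)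
    fix p f
    have "(\<Prod>v<k. T v ((f(k := p)) v) ((f(k := p, Suc k := q)) (Suc v))) =
       (\<Prod>v<k. T v (f v) ((f(k := p)) (Suc v)))"
      by (intro prod.cong refl) auto
    moreover have "(\<Prod>v<k. g v ((f(k := p)) v)) = (\<Prod>v<k. g v (f v))"
      by (intro prod.cong refl) auto
    ultimately show "(\<Prod>v<Suc k. T v ((f(k := p)) v) ((f(k := p, Suc k := q)) (Suc v))) *
          (\<Prod>v<Suc k. g v ((f(k := p)) v)) * g (Suc k) q =
      ((\<Prod>v<k. T v (f v) ((f(k := p)) (Suc v))) * (\<Prod>v<k. g v (f v)) * g k p) * T k p q * g (Suc k) q"
      by (simp add: mult_ac)
  qed
  also have "\<dots> = transfer_vec S T g (Suc k) q"
    by (simp add: Suc.IH sum_distrib_right)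
  finally show ?case by simp
qed

text \<open>The difference \<open>\<alpha> v - \<alpha> (Suc v)\<close> is the multiplicity of the
  part \<open>Suc v\<close>; the absolute value lets one weight serve steps up and down.\<close>

definition hl_step :: "'a::comm_ring_1 \<Rightarrow> nat \<Rightarrow> 'a \<Rightarrow> (nat \<Rightarrow> int) \<Rightarrow> (nat \<Rightarrow> int) \<Rightarrow> 'a" where
  "hl_step t N x \<alpha> \<beta> =
     (\<Prod>v<N. hl_factor t (\<alpha> v - \<alpha> (Suc v)) (\<beta> v - \<beta> (Suc v)) * x ^ nat \<bar>\<beta> v - \<alpha> v\<bar>)"

definition cols :: "nat \<Rightarrow> (nat \<Rightarrow> int) set" where
  "cols N = {f. (\<forall>v. f (Suc v) \<le> f v) \<and> (\<forall>v\<ge>N. f v = 0)}"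

text \<open>At most one new box per column: the two partitions differ by a horizontal strip.\<close>

definition up_cols :: "nat \<Rightarrow> (nat \<Rightarrow> int) \<Rightarrow> (nat \<Rightarrow> int) set" where
  "up_cols N \<alpha> = {\<beta> \<in> cols N. \<forall>v. \<beta> v - \<alpha> v \<in> {0, 1}}"

definition dn_cols :: "nat \<Rightarrow> (nat \<Rightarrow> int) \<Rightarrow> (nat \<Rightarrow> int) set" where
  "dn_cols N \<alpha> = {\<beta> \<in> cols N. \<forall>v. \<alpha> v - \<beta> v \<in> {0, 1}}"

lemma cols_nonneg:
  assumes "f \<in> cols N" shows "f v \<ge> 0"
proof (cases "v \<le> N")
  case True
  have "f N \<le> f v"
    using assms by (intro lift_Suc_antimono_le[OF _ True]) (simp add: cols_def)
  then show ?thesis using assms by (simp add: cols_def)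
qed (use assms in \<open>simp add: cols_def\<close>)

section \<open>The two-state transfer matrix for a pair of partitions\<close>

text \<open>In the locale below, \<open>L k p\<close> and \<open>K k p\<close> sum over the columns \<open>0..k\<close> of all intermediate partitions above,
  respectively below, both \<open>\<mu>\<close> and \<open>\<nu>\<close> with column \<open>k\<close> of length \<open>p\<close>. If \<open>\<mu> k \<noteq> \<nu> k\<close>, the column is forced;
  otherwise there are two states, and the two linear relations between them propagate.\<close>

locale corner =
  fixes t x y :: "'a::comm_ring_1" and \<mu> \<nu> :: "nat \<Rightarrow> int"
  assumes decr: "\<mu> (Suc v) \<le> \<mu> v" "\<nu> (Suc v) \<le> \<nu> v"
    and close: "\<bar>\<mu> v - \<nu> v\<bar> \<le> 1"
begin

text \<open>One factor for the step from \<mu> to the intermediate partition and one for the step on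
  to \<nu>. Both depend on the multiplicity \<open>p - q\<close>, hence on two neighbouring
  columns.\<close>

definition "T k p q = hl_factor t (\<mu> k - \<mu> (Suc k)) (p - q) * hl_factor t (p - q) (\<nu> k - \<nu> (Suc k))"
definition "Up k = {p. p - \<mu> k \<in> {0, 1} \<and> p - \<nu> k \<in> {0, 1}}"
definition "Dn k = {p. \<mu> k - p \<in> {0, 1} \<and> \<nu> k - p \<in> {0, 1}}"
definition "L = transfer_vec Up T (\<lambda>v p. x ^ nat \<bar>p - \<mu> v\<bar> * y ^ nat \<bar>\<nu> v - p\<bar>)"
definition "K = transfer_vec Dn T (\<lambda>v p. y ^ nat \<bar>p - \<mu> v\<bar> * x ^ nat \<bar>\<nu> v - p\<bar>)"

lemma Up_cases:
  "\<mu> k = \<nu> k \<Longrightarrow> Up k = {\<mu> k, \<mu> k + 1}" "\<mu> k = \<nu> k \<Longrightarrow> Dn k = {\<mu> k, \<mu> k - 1}"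
  "\<mu> k = \<nu> k + 1 \<Longrightarrow> Up k = {\<mu> k}" "\<mu> k = \<nu> k + 1 \<Longrightarrow> Dn k = {\<nu> k}"
  "\<nu> k = \<mu> k + 1 \<Longrightarrow> Up k = {\<nu> k}" "\<nu> k = \<mu> k + 1 \<Longrightarrow> Dn k = {\<mu> k}"
  by (auto simp: Up_def Dn_def)

lemma finite_Up: "finite (Up k)" and finite_Dn: "finite (Dn k)"
proof -
  have "Up k \<subseteq> {\<mu> k..\<mu> k + 1}" "Dn k \<subseteq> {\<mu> k - 1..\<mu> k}"
    by (auto simp: Up_def Dn_def)
  then show "finite (Up k)" "finite (Dn k)"
    by (meson finite_atLeastAtMost_int finite_subset)+
qed

lemma trichotomy: "\<mu> k = \<nu> k \<or> \<mu> k = \<nu> k + 1 \<or> \<nu> k = \<mu> k + 1"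
  using close[of k] by auto

text \<open>Induction over the columns. Where \<mu> and \<nu> agree, the states above and below do
  not match one by one, but the totals do, and so does a second combination weighted by
  \<open>t\<close> and \<open>x * y\<close>. A forced column leaves a single state, and then plain
  equality survives.\<close>

lemma invariant:
  "(\<mu> k = \<nu> k \<longrightarrow> L k (\<mu> k) + L k (\<mu> k + 1) = K k (\<mu> k) + K k (\<mu> k - 1) \<and>
      x * y * L k (\<mu> k) + t * L k (\<mu> k + 1) = t * x * y * K k (\<mu> k) + K k (\<mu> k - 1)) \<and>
   (\<mu> k = \<nu> k + 1 \<longrightarrow> L k (\<mu> k) = K k (\<nu> k)) \<and>
   (\<nu> k = \<mu> k + 1 \<longrightarrow> L k (\<nu> k) = K k (\<mu> k))"
proof (induction k)
  case 0
  then show ?case by (auto simp: L_def K_def algebra_simps)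
next
  case (Suc k)
  have LS: "L (Suc k) q = (\<Sum>p\<in>Up k. L k p * T k p q) * (x ^ nat \<bar>q - \<mu> (Suc k)\<bar> * y ^ nat \<bar>\<nu> (Suc k) - q\<bar>)" for q
    by (simp add: L_def)
  have KS: "K (Suc k) q = (\<Sum>p\<in>Dn k. K k p * T k p q) * (y ^ nat \<bar>q - \<mu> (Suc k)\<bar> * x ^ nat \<bar>\<nu> (Suc k) - q\<bar>)" for q
    by (simp add: K_def)
  \<comment> \<open>The multiplicity of the part \<open>Suc k\<close> in \<nu>; the other
    multiplicities in the weights differ from it by small shifts.\<close>
  define m where "m = nat (\<nu> k - \<nu> (Suc k))"
  have m: "\<nu> k = \<nu> (Suc k) + int m"
    using decr(2)[of k] by (simp add: m_def)
  have n: "nat (1 + int m) = Suc m" "nat (int m + 1) = Suc m" by auto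
  consider "\<mu> k = \<nu> k" | "\<mu> k = \<nu> k + 1" | "\<nu> k = \<mu> k + 1"
    using trichotomy[of k] by blast
  then show ?case
  proof cases
    case 1
    define a b a' b' where ab: "a = L k (\<mu> k)" "b = L k (\<mu> k + 1)" "a' = K k (\<mu> k)" "b' = K k (\<mu> k - 1)"
    have i: "a + b = a' + b'" and ii: "x * y * a + t * b = t * x * y * a' + b'"
      using Suc 1 by (auto simp: ab)
    have LS': "L (Suc k) q = (a * T k (\<mu> k) q + b * T k (\<mu> k + 1) q) * (x ^ nat \<bar>q - \<mu> (Suc k)\<bar> * y ^ nat \<bar>\<nu> (Suc k) - q\<bar>)" for q
      using 1 by (simp add: LS Up_cases ab)
    have KS': "K (Suc k) q = (a' * T k (\<mu> k) q + b' * T k (\<mu> k - 1) q) * (y ^ nat \<bar>q - \<mu> (Suc k)\<bar> * x ^ nat \<bar>\<nu> (Suc k) - q\<bar>)" for q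
      using 1 by (simp add: KS Up_cases ab)
    consider "\<mu> (Suc k) = \<nu> (Suc k)" | "\<mu> (Suc k) = \<nu> (Suc k) + 1" | "\<nu> (Suc k) = \<mu> (Suc k) + 1"
      using trichotomy[of "Suc k"] by blast
    then show ?thesis
    proof cases
      case 1
      have 2: "\<mu> k = \<nu> (Suc k) + int m" using \<open>\<mu> k = \<nu> k\<close> m by simp
      have L0: "L (Suc k) (\<mu> (Suc k)) = a + b * (1 - t ^ Suc m)"
        and L1: "L (Suc k) (\<mu> (Suc k) + 1) = (a * (1 - t ^ m) + b) * (x * y)"
        and K0: "K (Suc k) (\<mu> (Suc k)) = a' + b' * (1 - t ^ m)"
        and K1: "K (Suc k) (\<mu> (Suc k) - 1) = (a' * (1 - t ^ Suc m) + b') * (x * y)"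
        unfolding LS' KS' T_def by (simp_all add: hl_factor_def 1 2 m n)
      \<comment> \<open>Both new relations are linear combinations of the old ones \<open>i\<close>
        and \<open>ii\<close>; these two identities exhibit the coefficients.\<close>
      have "a + b * (1 - t ^ Suc m) + (a * (1 - t ^ m) + b) * (x * y) -
         (a' + b' * (1 - t ^ m) + (a' * (1 - t ^ Suc m) + b') * (x * y)) =
         (1 + x * y) * ((a + b) - (a' + b')) - t ^ m * ((x * y * a + t * b) - (t * x * y * a' + b'))"
        by (simp add: algebra_simps)
      moreover have "x * y * (a + b * (1 - t ^ Suc m)) + t * ((a * (1 - t ^ m) + b) * (x * y)) -
         (t * x * y * (a' + b' * (1 - t ^ m)) + (a' * (1 - t ^ Suc m) + b') * (x * y)) =
         x * y * (1 + t - t ^ Suc m) * ((a + b) - (a' + b'))"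
        by (simp add: algebra_simps)
      ultimately show ?thesis
        unfolding L0 L1 K0 K1 using 1 i ii by simp
    next
      case 2
      have 3: "\<mu> k = \<nu> (Suc k) + int m" using \<open>\<mu> k = \<nu> k\<close> m by simp
      \<comment> \<open>The next column is forced, and all four transitions into it have the same
        weight, so the relation \<open>i\<close> between the totals suffices.\<close>
      show ?thesis
        unfolding LS' KS' T_def using i
        by (simp add: hl_factor_def 2 3 m n flip: distrib_right)
    next
      case 3
      have 4: "\<mu> k = \<mu> (Suc k) + 1 + int m" using \<open>\<mu> k = \<nu> k\<close> m 3 by simp
      show ?thesis
        unfolding LS' KS' T_def using i
        by (simp add: hl_factor_def 3 4 m n flip: distrib_right)
    qed
  next
    case 2
    define a where a: "a = L k (\<mu> k)" 
    have a': "a = K k (\<nu> k)"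
      using Suc 2 by (auto simp: a)
    have LS': "L (Suc k) q = a * T k (\<mu> k) q * (x ^ nat \<bar>q - \<mu> (Suc k)\<bar> * y ^ nat \<bar>\<nu> (Suc k) - q\<bar>)" for q
      using 2 by (simp add: LS Up_cases a)
    have KS': "K (Suc k) q = a * T k (\<nu> k) q * (y ^ nat \<bar>q - \<mu> (Suc k)\<bar> * x ^ nat \<bar>\<nu> (Suc k) - q\<bar>)" for q
      using 2 by (simp add: KS Up_cases a')
    have 3: "\<mu> k = \<nu> (Suc k) + int m + 1" using 2 m by simp
    show ?thesis
      unfolding LS' KS' T_def using trichotomy[of "Suc k"] decr(1)[of k]
      by (auto simp: hl_factor_def 3 m n algebra_simps)
  next
    case 3
    define a where a: "a = L k (\<nu> k)" 
    have a': "a = K k (\<mu> k)"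
      using Suc 3 by (auto simp: a)
    have LS': "L (Suc k) q = a * T k (\<nu> k) q * (x ^ nat \<bar>q - \<mu> (Suc k)\<bar> * y ^ nat \<bar>\<nu> (Suc k) - q\<bar>)" for q
      using 3 by (simp add: LS Up_cases a)
    have KS': "K (Suc k) q = a * T k (\<mu> k) q * (y ^ nat \<bar>q - \<mu> (Suc k)\<bar> * x ^ nat \<bar>\<nu> (Suc k) - q\<bar>)" for q
      using 3 by (simp add: KS Up_cases a')
    have 4: "\<mu> k = \<nu> (Suc k) + int m - 1" using 3 m by simp
    show ?thesis
      unfolding LS' KS' T_def using trichotomy[of "Suc k"] decr(1)[of k]
      by (auto simp: hl_factor_def 4 m n algebra_simps)
  qed
qed

text \<open>An ascent \<open>p < q\<close> squeezes \<nu> to equal lengths in columns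
  \<open>k\<close> and \<open>Suc k\<close>, so the second factor is \<open>1 - t ^ 0 = 0\<close>.
  Paths that are not partitions thus drop out by themselves.\<close>

lemma ascent_vanishes:
  assumes "p \<in> Up k \<and> q \<in> Up (Suc k) \<or> p \<in> Dn k \<and> q \<in> Dn (Suc k)" "p < q"
  shows "T k p q = 0"
proof -
  have "nat (\<nu> k - \<nu> (Suc k)) = 0"
    using assms decr[of k] by (auto simp: Up_def Dn_def)
  moreover have "p - q < \<nu> k - \<nu> (Suc k)"
    using assms(2) decr(2)[of k] by simp
  ultimately show ?thesis
    by (simp add: T_def hl_factor_def)
qed

text \<open>Paths of nonzero weight are antitone, so a column \<open>k\<close> of length
  \<open>q\<close> comes with at least \<open>Suc k * q\<close> boxes in columns 0 to
  \<open>k\<close>. Each of them lies in \<mu> or was added with a factor \<open>x\<close>.\<close>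

lemma L_dvd:
  assumes z: "z dvd x" and pos: "\<And>v. \<mu> v \<ge> 0"
  shows "q \<in> Up k \<Longrightarrow> z ^ (Suc k * nat q) dvd z ^ (\<Sum>v\<le>k. nat (\<mu> v)) * L k q"
proof (induction k arbitrary: q)
  case 0
  have q: "nat q = nat (\<mu> 0) + nat \<bar>q - \<mu> 0\<bar>"
    using 0 pos[of 0] by (auto simp: Up_def)
  have "z ^ nat q dvd z ^ nat (\<mu> 0) * x ^ nat \<bar>q - \<mu> 0\<bar>"
    unfolding q power_add using z by (intro mult_dvd_mono dvd_refl dvd_power_same)
  then show ?case by (simp add: L_def mult.assoc[symmetric])
next
  case (Suc k)
  have q: "nat q = nat (\<mu> (Suc k)) + nat \<bar>q - \<mu> (Suc k)\<bar>"
    using Suc.prems pos[of "Suc k"] by (auto simp: Up_def)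
  have g: "z ^ nat q dvd z ^ nat (\<mu> (Suc k)) * x ^ nat \<bar>q - \<mu> (Suc k)\<bar>"
    unfolding q power_add using z by (intro mult_dvd_mono dvd_refl dvd_power_same)
  have "z ^ (Suc k * nat q) dvd z ^ (\<Sum>v\<le>k. nat (\<mu> v)) * (L k p * T k p q)" if p: "p \<in> Up k" for p
  proof (cases "p < q")
    case True
    then show ?thesis using ascent_vanishes[of p k q] p Suc.prems by simp
  next
    case False
    have "z ^ (Suc k * nat q) dvd z ^ (Suc k * nat p)"
      using False by (intro le_imp_power_dvd mult_le_mono2 nat_mono) simp
    also have "\<dots> dvd z ^ (\<Sum>v\<le>k. nat (\<mu> v)) * L k p"
      by (rule Suc.IH[OF p])
    finally show ?thesis by (simp add: mult.assoc[symmetric])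
  qed
  then have "z ^ (Suc k * nat q) dvd z ^ (\<Sum>v\<le>k. nat (\<mu> v)) * (\<Sum>p\<in>Up k. L k p * T k p q)"
    unfolding sum_distrib_left by (intro dvd_sum) simp
  from mult_dvd_mono[OF this g]
  have "z ^ (Suc (Suc k) * nat q) dvd z ^ (\<Sum>v\<le>k. nat (\<mu> v)) * (\<Sum>p\<in>Up k. L k p * T k p q) *
     (z ^ nat (\<mu> (Suc k)) * x ^ nat \<bar>q - \<mu> (Suc k)\<bar>) * y ^ nat \<bar>\<nu> (Suc k) - q\<bar>"
    by (simp add: power_add[symmetric] add.commute)
  then show ?case
    by (simp add: L_def power_add mult_ac)
qed

text \<open>Summing over all admissible paths instead of the antitone ones changes nothing, because
  ascents carry weight zero. The free \<open>x'\<close> and \<open>y'\<close> cover both orders of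
  the steps, which exchange \<open>x\<close> and \<open>y\<close>.\<close>

lemma sum_chain_eq_transfer_vec:
  assumes "\<mu> \<in> cols N" "\<nu> \<in> cols N"
    and S: "S = Up \<or> S = Dn"
  shows "(\<Sum>f | f \<in> cols N \<and> (\<forall>v. f v \<in> S v). hl_step t N x' \<mu> f * hl_step t N y' f \<nu>) =
    transfer_vec S T (\<lambda>v p. x' ^ nat \<bar>p - \<mu> v\<bar> * y' ^ nat \<bar>\<nu> v - p\<bar>) N 0"
proof -
  have fin: "finite (state_paths S N)"
    using S finite_Up finite_Dn by (intro finite_state_paths) auto
  have z: "\<mu> v = 0" "\<nu> v = 0" if "v \<ge> N" for v
    using assms that by (auto simp: cols_def)
  let ?A = "{f. f \<in> cols N \<and> (\<forall>v. f v \<in> S v)}"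
  have "transfer_vec S T (\<lambda>v p. x' ^ nat \<bar>p - \<mu> v\<bar> * y' ^ nat \<bar>\<nu> v - p\<bar>) N 0 =
     (\<Sum>f\<in>state_paths S N. (\<Prod>v<N. T v (f v) (f (Suc v))) *
         (\<Prod>v<N. x' ^ nat \<bar>f v - \<mu> v\<bar> * y' ^ nat \<bar>\<nu> v - f v\<bar>))"
    unfolding transfer_vec_eq_sum
  proof (intro sum.cong refl)
    fix f assume "f \<in> state_paths S N"
    then have "f(N := 0) = f" by (auto simp: state_paths_def)
    then show "(\<Prod>v<N. T v (f v) ((f(N := 0)) (Suc v))) * (\<Prod>v<N. x' ^ nat \<bar>f v - \<mu> v\<bar> * y' ^ nat \<bar>\<nu> v - f v\<bar>) *
        (x' ^ nat \<bar>0 - \<mu> N\<bar> * y' ^ nat \<bar>\<nu> N - 0\<bar>) =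
       (\<Prod>v<N. T v (f v) (f (Suc v))) * (\<Prod>v<N. x' ^ nat \<bar>f v - \<mu> v\<bar> * y' ^ nat \<bar>\<nu> v - f v\<bar>)"
      by (simp add: z)
  qed
  also have "\<dots> = (\<Sum>f\<in>?A. (\<Prod>v<N. T v (f v) (f (Suc v))) *
         (\<Prod>v<N. x' ^ nat \<bar>f v - \<mu> v\<bar> * y' ^ nat \<bar>\<nu> v - f v\<bar>))"
  proof (intro sum.mono_neutral_right fin ballI)
    show "?A \<subseteq> state_paths S N"
      by (auto simp: state_paths_def cols_def)
    fix f assume f: "f \<in> state_paths S N - ?A"
    have fS: "f v \<in> S v" for v
    proof (cases "v < N")
      case True
      then show ?thesis using f by (auto simp: state_paths_def)
    next
      case False
      then have "f v = 0" using f by (auto simp: state_paths_def)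
      then show ?thesis using S z[of v] False by (auto simp: Up_def Dn_def)
    qed
    then obtain v where v: "f v < f (Suc v)"
      using f by (fastforce simp: state_paths_def cols_def not_le)
    then have "v < N"
      using f by (fastforce simp: state_paths_def not_less)
    moreover have "T v (f v) (f (Suc v)) = 0"
      using v fS[of v] fS[of "Suc v"] S by (intro ascent_vanishes) auto
    ultimately show "(\<Prod>v<N. T v (f v) (f (Suc v))) *
         (\<Prod>v<N. x' ^ nat \<bar>f v - \<mu> v\<bar> * y' ^ nat \<bar>\<nu> v - f v\<bar>) = 0"
      by (subst prod_zero) auto
  qed
  also have "\<dots> = (\<Sum>f\<in>?A. hl_step t N x' \<mu> f * hl_step t N y' f \<nu>)"
    by (intro sum.cong refl) (simp add: hl_step_def T_def prod.distrib[symmetric] mult_ac)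
  finally show ?thesis by simp
qed

end

text \<open>The error term \<open>e\<close> collects the partitions that would use column \<open>N\<close>.\<close>

theorem skew_cauchy_truncated:
  fixes t x y z :: "'a::comm_ring_1"
  assumes "\<mu> \<in> cols N" "\<nu> \<in> cols N" "z dvd x"
  obtains e where
    "(1 - x * y) * (\<Sum>f | f \<in> up_cols N \<mu> \<and> \<nu> \<in> dn_cols N f. hl_step t N x \<mu> f * hl_step t N y f \<nu>) =
     (1 - t * x * y) * (\<Sum>f | f \<in> dn_cols N \<mu> \<and> \<nu> \<in> up_cols N f. hl_step t N y \<mu> f * hl_step t N x f \<nu>) - e"
    "z ^ Suc N dvd z ^ (\<Sum>v<N. nat (\<mu> v)) * e"
proof (cases "\<forall>v. \<bar>\<mu> v - \<nu> v\<bar> \<le> 1")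
  case False
  then obtain v where v: "\<bar>\<mu> v - \<nu> v\<bar> > 1" by (auto simp: not_le)
  have 1: "{f. f \<in> up_cols N \<mu> \<and> \<nu> \<in> dn_cols N f} = {}"
  proof (intro equals0I, unfold mem_Collect_eq)
    fix f
    assume "f \<in> up_cols N \<mu> \<and> \<nu> \<in> dn_cols N f"
    then have "f v - \<mu> v \<in> {0, 1}" "f v - \<nu> v \<in> {0, 1}"
      by (auto simp: up_cols_def dn_cols_def)
    then show False using v by auto
  qed
  have 2: "{f. f \<in> dn_cols N \<mu> \<and> \<nu> \<in> up_cols N f} = {}"
  proof (intro equals0I, unfold mem_Collect_eq)
    fix f
    assume "f \<in> dn_cols N \<mu> \<and> \<nu> \<in> up_cols N f"
    then have "\<mu> v - f v \<in> {0, 1}" "\<nu> v - f v \<in> {0, 1}"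
      by (auto simp: up_cols_def dn_cols_def)
    then show False using v by auto
  qed
  show ?thesis by (rule that[of 0]) (simp_all only: 1 2, simp_all)
next
  case True
  interpret corner t x y \<mu> \<nu>
    using assms True by unfold_locales (auto simp: cols_def)
  have z: "\<mu> N = 0" "\<nu> N = 0" using assms by (auto simp: cols_def)
  have "{f. f \<in> up_cols N \<mu> \<and> \<nu> \<in> dn_cols N f} = {f. f \<in> cols N \<and> (\<forall>v. f v \<in> Up v)}"
    using assms by (auto simp: up_cols_def dn_cols_def Up_def)
  then have 1: "(\<Sum>f | f \<in> up_cols N \<mu> \<and> \<nu> \<in> dn_cols N f. hl_step t N x \<mu> f * hl_step t N y f \<nu>) = L N 0"
    using sum_chain_eq_transfer_vec[of N Up x y] assms by (simp add: L_def)
  have "{f. f \<in> dn_cols N \<mu> \<and> \<nu> \<in> up_cols N f} = {f. f \<in> cols N \<and> (\<forall>v. f v \<in> Dn v)}"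
    using assms by (auto simp: up_cols_def dn_cols_def Dn_def)
  then have 2: "(\<Sum>f | f \<in> dn_cols N \<mu> \<and> \<nu> \<in> up_cols N f. hl_step t N y \<mu> f * hl_step t N x f \<nu>) = K N 0"
    using sum_chain_eq_transfer_vec[of N Dn y x] assms by (simp add: K_def)
  show ?thesis
  proof (rule that[of "(1 - t) * L N 1"])
    \<comment> \<open>At column \<open>N\<close> the state 0 gives the two true sums. The state 1
      above is a partition with a box in column \<open>N\<close>; the state -1 below is spurious and
      is eliminated by subtracting the two relations.\<close>
    have *: "L N 0 + L N 1 = K N 0 + K N (- 1)" "x * y * L N 0 + t * L N 1 = t * x * y * K N 0 + K N (- 1)"
      using invariant[of N] by (simp_all add: z)
    have "(1 - x * y) * L N 0 - ((1 - t * x * y) * K N 0 - (1 - t) * L N 1) =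
      ((L N 0 + L N 1) - (K N 0 + K N (- 1))) -
      ((x * y * L N 0 + t * L N 1) - (t * x * y * K N 0 + K N (- 1)))"
      by (simp add: algebra_simps)
    also have "\<dots> = 0" unfolding * by simp
    finally show "(1 - x * y) * (\<Sum>f | f \<in> up_cols N \<mu> \<and> \<nu> \<in> dn_cols N f. hl_step t N x \<mu> f * hl_step t N y f \<nu>) =
     (1 - t * x * y) * (\<Sum>f | f \<in> dn_cols N \<mu> \<and> \<nu> \<in> up_cols N f. hl_step t N y \<mu> f * hl_step t N x f \<nu>) -
     (1 - t) * L N 1"
      unfolding 1 2 by simp
    have "1 \<in> Up N" by (simp add: Up_def z)
    from L_dvd[OF assms(3) _ this] cols_nonneg[OF assms(1)]
    have "z ^ Suc N dvd z ^ (\<Sum>v<N. nat (\<mu> v)) * L N 1"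
      by (simp add: z flip: lessThan_Suc_atMost)
    then show "z ^ Suc N dvd z ^ (\<Sum>v<N. nat (\<mu> v)) * ((1 - t) * L N 1)"
      by (metis dvd_mult mult.left_commute)
  qed
qed

section \<open>Chains of up and down steps\<close>

abbreviation hl_wt :: "nat \<Rightarrow> nat \<Rightarrow> (nat \<Rightarrow> int) \<Rightarrow> (nat \<Rightarrow> int) \<Rightarrow> int poly fps" where
  "hl_wt N e \<equiv> hl_step (fps_const tvar) N (fps_X ^ e)"

definition moves :: "nat \<Rightarrow> bool \<Rightarrow> (nat \<Rightarrow> int) \<Rightarrow> (nat \<Rightarrow> int) set" where
  "moves N up \<alpha> = (if up then up_cols N \<alpha> else dn_cols N \<alpha>)"

text \<open>A letter \<open>(b, e)\<close> stands for a step up (\<open>b\<close>) or down (\<open>\<not> b\<close>) of weight \<open>s^e\<close> per box.\<close>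

fun chain_sum :: "nat \<Rightarrow> (bool \<times> nat) list \<Rightarrow> (nat \<Rightarrow> int) \<Rightarrow> int poly fps" where
  "chain_sum N [] \<alpha> = (if \<alpha> = (\<lambda>_. 0) then 1 else 0)"
| "chain_sum N ((b, e) # ws) \<alpha> = (\<Sum>\<beta>\<in>moves N b \<alpha>. hl_wt N e \<alpha> \<beta> * chain_sum N ws \<beta>)"

definition csize :: "nat \<Rightarrow> (nat \<Rightarrow> int) \<Rightarrow> nat" where
  "csize N \<alpha> = (\<Sum>v<N. nat (\<alpha> v))"

text \<open>The factor \<open>s^|\<alpha>|\<close> accounts for the steps that have led up to \<open>\<alpha>\<close>.\<close>

definition trunc_eq :: "nat \<Rightarrow> (nat \<Rightarrow> int) \<Rightarrow> int poly fps \<Rightarrow> int poly fps \<Rightarrow> bool" where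
  "trunc_eq N \<alpha> f g \<longleftrightarrow> fps_X ^ Suc N dvd fps_X ^ csize N \<alpha> * (f - g)"

lemma finite_moves: "finite (moves N b \<alpha>)"
proof (rule finite_subset)
  show "moves N b \<alpha> \<subseteq> state_paths (\<lambda>v. {\<alpha> v - 1, \<alpha> v, \<alpha> v + 1}) N"
  proof
    fix \<beta> assume \<beta>: "\<beta> \<in> moves N b \<alpha>"
    then have "\<beta> v - \<alpha> v \<in> {0, 1} \<or> \<alpha> v - \<beta> v \<in> {0, 1}" for v
      by (auto simp: moves_def up_cols_def dn_cols_def split: if_splits)
    then have "\<beta> v \<in> {\<alpha> v - 1, \<alpha> v, \<alpha> v + 1}" for v
      by (smt (verit, best) insertCI insertE singletonD)
    then show "\<beta> \<in> state_paths (\<lambda>v. {\<alpha> v - 1, \<alpha> v, \<alpha> v + 1}) N"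
      using \<beta> by (auto simp: moves_def up_cols_def dn_cols_def state_paths_def cols_def split: if_splits)
  qed
qed (simp add: finite_state_paths)

lemma moves_cols: "\<beta> \<in> moves N b \<alpha> \<Longrightarrow> \<beta> \<in> cols N"
  by (auto simp: moves_def up_cols_def dn_cols_def split: if_splits)

lemma zero_cols: "(\<lambda>_. 0) \<in> cols N"
  by (simp add: cols_def)

lemma trunc_eq_trans: "trunc_eq N \<alpha> f g \<Longrightarrow> trunc_eq N \<alpha> g h \<Longrightarrow> trunc_eq N \<alpha> f h"
  unfolding trunc_eq_def by (drule (1) dvd_add) (simp flip: distrib_left)

lemma trunc_eq_mult: "trunc_eq N \<alpha> f g \<Longrightarrow> trunc_eq N \<alpha> (h * f) (h * g)"
  unfolding trunc_eq_def by (metis dvd_mult mult.left_commute right_diff_distrib)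

text \<open>A step up pays at least one factor s for each added box, and a step down only removes
  boxes. So the size factor before a step, times its weight, covers the size factor after
  it.\<close>

lemma hl_wt_dvd:
  assumes "\<alpha> \<in> cols N" "\<beta> \<in> moves N b \<alpha>" "b \<Longrightarrow> e \<ge> 1"
  shows "fps_X ^ csize N \<beta> dvd fps_X ^ csize N \<alpha> * hl_wt N e \<alpha> \<beta>"
proof -
  have "fps_X ^ nat (\<beta> v) dvd fps_X ^ nat (\<alpha> v) *
     (hl_factor (fps_const tvar) (\<alpha> v - \<alpha> (Suc v)) (\<beta> v - \<beta> (Suc v)) * (fps_X ^ e) ^ nat \<bar>\<beta> v - \<alpha> v\<bar>)" for v
  proof -
    have "nat (\<beta> v) \<le> nat (\<alpha> v) + e * nat \<bar>\<beta> v - \<alpha> v\<bar>"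
    proof (cases "\<beta> v \<le> \<alpha> v")
      case False
      then have "b" "\<beta> v = \<alpha> v + 1"
        using assms(2) by (auto simp: moves_def up_cols_def dn_cols_def split: if_splits dest!: spec[of _ v])
      then show ?thesis using assms(3) cols_nonneg[OF assms(1), of v] by simp
    qed simp
    then have "fps_X ^ nat (\<beta> v) dvd (fps_X ^ (nat (\<alpha> v) + e * nat \<bar>\<beta> v - \<alpha> v\<bar>) :: int poly fps)"
      by (rule le_imp_power_dvd)
    then show ?thesis
      by (metis dvd_mult mult.left_commute power_add power_mult)
  qed
  then have "(\<Prod>v<N. fps_X ^ nat (\<beta> v)) dvd (\<Prod>v<N. fps_X ^ nat (\<alpha> v) *
     (hl_factor (fps_const tvar) (\<alpha> v - \<alpha> (Suc v)) (\<beta> v - \<beta> (Suc v)) * (fps_X ^ e) ^ nat \<bar>\<beta> v - \<alpha> v\<bar>))"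
    by (intro prod_dvd_prod) simp
  then show ?thesis
    by (simp add: csize_def hl_step_def prod.distrib power_sum)
qed

text \<open>Congruences survive prefixing a letter: by \<open>hl_wt_dvd\<close>, the size factor
  needed at \<beta> is supplied by the one at \<alpha> together with the step.\<close>

lemma chain_sum_Cons_trunc_eq:
  assumes "\<And>\<beta>. \<beta> \<in> cols N \<Longrightarrow> trunc_eq N \<beta> (chain_sum N ws \<beta>) (f * chain_sum N ws' \<beta>)"
    and "\<alpha> \<in> cols N" "b \<Longrightarrow> e \<ge> 1"
  shows "trunc_eq N \<alpha> (chain_sum N ((b, e) # ws) \<alpha>) (f * chain_sum N ((b, e) # ws') \<alpha>)"
proof -
  have "fps_X ^ Suc N dvd fps_X ^ csize N \<alpha> * (hl_wt N e \<alpha> \<beta> * (chain_sum N ws \<beta> - f * chain_sum N ws' \<beta>))"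
    if \<beta>: "\<beta> \<in> moves N b \<alpha>" for \<beta>
  proof -
    obtain h where h: "fps_X ^ csize N \<alpha> * hl_wt N e \<alpha> \<beta> = fps_X ^ csize N \<beta> * h"
      using hl_wt_dvd[OF assms(2) \<beta> assms(3)] by (auto elim: dvdE)
    have "fps_X ^ Suc N dvd fps_X ^ csize N \<beta> * (chain_sum N ws \<beta> - f * chain_sum N ws' \<beta>)"
      using assms(1)[OF moves_cols[OF \<beta>]] by (simp add: trunc_eq_def)
    then have "fps_X ^ Suc N dvd h * (fps_X ^ csize N \<beta> * (chain_sum N ws \<beta> - f * chain_sum N ws' \<beta>))"
      by (rule dvd_mult)
    also have "\<dots> = (fps_X ^ csize N \<beta> * h) * (chain_sum N ws \<beta> - f * chain_sum N ws' \<beta>)"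
      by (simp only: mult_ac)
    finally show ?thesis unfolding h[symmetric] by (simp only: mult_ac)
  qed
  then have "fps_X ^ Suc N dvd (\<Sum>\<beta>\<in>moves N b \<alpha>. fps_X ^ csize N \<alpha> * (hl_wt N e \<alpha> \<beta> * (chain_sum N ws \<beta> - f * chain_sum N ws' \<beta>)))"
    by (rule dvd_sum)
  also have "\<dots> = fps_X ^ csize N \<alpha> * (chain_sum N ((b, e) # ws) \<alpha> - f * chain_sum N ((b, e) # ws') \<alpha>)"
    by (simp add: sum_distrib_left sum_subtractf right_diff_distrib mult_ac)
  finally show ?thesis by (simp add: trunc_eq_def)
qed

text \<open>Grouping by the endpoint \<nu> isolates the inner sum of the skew Cauchy identity. The
  common superset \<open>V\<close> of endpoints lets both orders of the steps be compared over one
  index set.\<close>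

lemma chain_sum_two_steps:
  assumes "finite V" "\<And>\<beta>. \<beta> \<in> moves N b \<alpha> \<Longrightarrow> moves N b' \<beta> \<subseteq> V"
  shows "chain_sum N ((b, e) # (b', e') # ws) \<alpha> =
    (\<Sum>\<nu>\<in>V. (\<Sum>\<beta> | \<beta> \<in> moves N b \<alpha> \<and> \<nu> \<in> moves N b' \<beta>. hl_wt N e \<alpha> \<beta> * hl_wt N e' \<beta> \<nu>) * chain_sum N ws \<nu>)"
proof -
  have "chain_sum N ((b, e) # (b', e') # ws) \<alpha> =
    (\<Sum>\<beta>\<in>moves N b \<alpha>. \<Sum>\<nu> | \<nu> \<in> V \<and> \<nu> \<in> moves N b' \<beta>. hl_wt N e \<alpha> \<beta> * (hl_wt N e' \<beta> \<nu> * chain_sum N ws \<nu>))"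
    unfolding chain_sum.simps sum_distrib_left
    by (intro sum.cong refl) (use assms(2) in auto)
  also have "\<dots> = (\<Sum>\<nu>\<in>V. \<Sum>\<beta> | \<beta> \<in> moves N b \<alpha> \<and> \<nu> \<in> moves N b' \<beta>. hl_wt N e \<alpha> \<beta> * (hl_wt N e' \<beta> \<nu> * chain_sum N ws \<nu>))"
    by (rule sum.swap_restrict[OF finite_moves assms(1)])
  finally show ?thesis by (simp add: sum_distrib_right mult.assoc)
qed

text \<open>The skew Cauchy identity at every endpoint, divided by
  \<open>1 - fps_X ^ (e + f)\<close>. This series is invertible since \<open>e\<close> is positive,
  even for \<open>f = 0\<close>.\<close>

lemma chain_sum_swap:
  assumes "\<alpha> \<in> cols N" "e \<ge> 1"
  shows "trunc_eq N \<alpha> (chain_sum N ((True, e) # (False, f) # ws) \<alpha>)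
    (macmahon_factor (e + f) * chain_sum N ((False, f) # (True, e) # ws) \<alpha>)"
proof -
  define V where "V = (\<Union>\<beta>\<in>moves N True \<alpha>. moves N False \<beta>) \<union> (\<Union>\<beta>\<in>moves N False \<alpha>. moves N True \<beta>)"
  have V: "finite V" by (auto simp: V_def finite_moves)
  have Vc: "\<nu> \<in> cols N" if "\<nu> \<in> V" for \<nu> using that by (auto simp: V_def intro: moves_cols)
  let ?x = "fps_X :: int poly fps"
  define A where "A = (\<lambda>\<nu>. \<Sum>\<beta> | \<beta> \<in> moves N True \<alpha> \<and> \<nu> \<in> moves N False \<beta>. hl_wt N e \<alpha> \<beta> * hl_wt N f \<beta> \<nu>)"
  define B where "B = (\<lambda>\<nu>. \<Sum>\<beta> | \<beta> \<in> moves N False \<alpha> \<and> \<nu> \<in> moves N True \<beta>. hl_wt N f \<alpha> \<beta> * hl_wt N e \<beta> \<nu>)"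
  have "\<exists>d. (1 - ?x ^ (e + f)) * A \<nu> = (1 - fps_const tvar * ?x ^ (e + f)) * B \<nu> - d \<and>
       ?x ^ Suc N dvd ?x ^ csize N \<alpha> * d" if "\<nu> \<in> V" for \<nu>
  proof -
    \<comment> \<open>Choosing s for the divisor \<open>z\<close> turns the error term into one that
      \<open>trunc_eq\<close> neglects.\<close>
    have x: "?x dvd ?x ^ e" using assms(2) by (cases e) auto
    show ?thesis
      by (rule skew_cauchy_truncated[OF assms(1) Vc[OF that] x, of "?x ^ f" "fps_const tvar"])
        (auto simp: A_def B_def moves_def power_add csize_def mult.assoc)
  qed
  then have "\<exists>d. \<forall>\<nu>\<in>V. (1 - ?x ^ (e + f)) * A \<nu> = (1 - fps_const tvar * ?x ^ (e + f)) * B \<nu> - d \<nu> \<and>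
       ?x ^ Suc N dvd ?x ^ csize N \<alpha> * d \<nu>"
    by (intro bchoice ballI)
  then obtain d where d: "\<And>\<nu>. \<nu> \<in> V \<Longrightarrow> (1 - ?x ^ (e + f)) * A \<nu> = (1 - fps_const tvar * ?x ^ (e + f)) * B \<nu> - d \<nu>"
    "\<And>\<nu>. \<nu> \<in> V \<Longrightarrow> ?x ^ Suc N dvd ?x ^ csize N \<alpha> * d \<nu>"
    by blast
  define D where "D = (\<Sum>\<nu>\<in>V. d \<nu> * chain_sum N ws \<nu>)"
  have UD: "chain_sum N ((True, e) # (False, f) # ws) \<alpha> = (\<Sum>\<nu>\<in>V. A \<nu> * chain_sum N ws \<nu>)"
    unfolding A_def B_def by (rule chain_sum_two_steps[OF V]) (auto simp: V_def)
  have DU: "chain_sum N ((False, f) # (True, e) # ws) \<alpha> = (\<Sum>\<nu>\<in>V. B \<nu> * chain_sum N ws \<nu>)"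
    unfolding A_def B_def by (rule chain_sum_two_steps[OF V]) (auto simp: V_def)
  have "(1 - ?x ^ (e + f)) * chain_sum N ((True, e) # (False, f) # ws) \<alpha> =
     (\<Sum>\<nu>\<in>V. ((1 - ?x ^ (e + f)) * A \<nu>) * chain_sum N ws \<nu>)"
    unfolding UD by (simp only: sum_distrib_left mult.assoc)
  also have "\<dots> = (\<Sum>\<nu>\<in>V. ((1 - fps_const tvar * ?x ^ (e + f)) * B \<nu> - d \<nu>) * chain_sum N ws \<nu>)"
    by (intro sum.cong refl) (simp only: d)
  also have "\<dots> = (1 - fps_const tvar * ?x ^ (e + f)) * chain_sum N ((False, f) # (True, e) # ws) \<alpha> - D"
    unfolding DU D_def by (simp only: sum_distrib_left mult.assoc left_diff_distrib sum_subtractf)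
  finally have eq: "(1 - ?x ^ (e + f)) * chain_sum N ((True, e) # (False, f) # ws) \<alpha> =
    (1 - fps_const tvar * ?x ^ (e + f)) * chain_sum N ((False, f) # (True, e) # ws) \<alpha> - D" .
  define I where "I = fps_left_inverse (1 - ?x ^ (e + f)) 1"
  have I: "I * (1 - ?x ^ (e + f)) = 1"
    unfolding I_def by (rule fps_left_inverse) (use assms in simp)
  have mf: "macmahon_factor (e + f) = I * (1 - fps_const tvar * ?x ^ (e + f))"
    by (simp add: macmahon_factor_def I_def mult.commute)
  have "chain_sum N ((True, e) # (False, f) # ws) \<alpha> =
     I * ((1 - ?x ^ (e + f)) * chain_sum N ((True, e) # (False, f) # ws) \<alpha>)"
    by (simp only: mult.assoc[symmetric] I mult_1)
  also have "\<dots> = macmahon_factor (e + f) * chain_sum N ((False, f) # (True, e) # ws) \<alpha> - I * D"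
    unfolding eq mf mult.assoc by (rule right_diff_distrib)
  finally have "chain_sum N ((True, e) # (False, f) # ws) \<alpha> -
     macmahon_factor (e + f) * chain_sum N ((False, f) # (True, e) # ws) \<alpha> = - (I * D)"
    by simp
  moreover have "?x ^ Suc N dvd ?x ^ csize N \<alpha> * D"
    unfolding D_def sum_distrib_left
    by (intro dvd_sum) (metis d(2) dvd_mult2 mult.assoc)
  then have "?x ^ Suc N dvd ?x ^ csize N \<alpha> * - (I * D)"
    by (metis dvd_minus_iff dvd_mult mult.left_commute mult_minus_right)
  ultimately show ?thesis by (simp only: trunc_eq_def)
qed

lemma chain_sum_move_down:
  assumes "\<forall>e\<in>set es. e \<ge> 1" "\<alpha> \<in> cols N"
  shows "trunc_eq N \<alpha> (chain_sum N (map (Pair True) es @ (False, f) # ws) \<alpha>)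
    ((\<Prod>e\<leftarrow>es. macmahon_factor (e + f)) * chain_sum N ((False, f) # map (Pair True) es @ ws) \<alpha>)"
  using assms
proof (induction es arbitrary: \<alpha>)
  case Nil
  then show ?case by (simp add: trunc_eq_def)
next
  case (Cons e es)
  define P where "P = (\<Prod>e\<leftarrow>es. macmahon_factor (e + f))"
  have "trunc_eq N \<alpha> (chain_sum N ((True, e) # map (Pair True) es @ (False, f) # ws) \<alpha>)
    (P * chain_sum N ((True, e) # (False, f) # map (Pair True) es @ ws) \<alpha>)"
    using Cons unfolding P_def by (intro chain_sum_Cons_trunc_eq) auto
  moreover have "trunc_eq N \<alpha> (P * chain_sum N ((True, e) # (False, f) # map (Pair True) es @ ws) \<alpha>)
     (P * (macmahon_factor (e + f) * chain_sum N ((False, f) # (True, e) # map (Pair True) es @ ws) \<alpha>))"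
    using Cons.prems by (intro trunc_eq_mult chain_sum_swap) auto
  ultimately show ?case
    by (auto dest: trunc_eq_trans simp: P_def mult_ac simp del: chain_sum.simps)
qed

lemma hl_step_zero: "hl_step t N x (\<lambda>_. 0) (\<lambda>_. 0) = 1"
  by (simp add: hl_step_def hl_factor_def)

lemma moves_down_zero: "moves N False (\<lambda>_. 0) = {\<lambda>_. 0}"
proof -
  have "\<beta> = (\<lambda>_. 0)" if "\<beta> \<in> moves N False (\<lambda>_. 0)" for \<beta>
  proof
    fix v
    have "\<beta> v \<le> 0" using that by (auto simp: moves_def dn_cols_def dest!: spec[of _ v])
    then show "\<beta> v = 0" using cols_nonneg[OF moves_cols[OF that], of v] by simp
  qed
  then show ?thesis by (auto simp: moves_def dn_cols_def zero_cols)
qed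

lemma chain_sum_down_zero: "chain_sum N ((False, f) # ws) (\<lambda>_. 0) = chain_sum N ws (\<lambda>_. 0)"
  by (simp add: moves_down_zero hl_step_zero)

text \<open>Steps up can end in the empty partition only if the chain is empty throughout.\<close>

lemma chain_sum_ups:
  "\<alpha> \<in> cols N \<Longrightarrow> chain_sum N (map (Pair True) es) \<alpha> = (if \<alpha> = (\<lambda>_. 0) then 1 else 0)"
proof (induction es arbitrary: \<alpha>)
  case (Cons e es)
  have "chain_sum N (map (Pair True) (e # es)) \<alpha> =
     (\<Sum>\<beta>\<in>moves N True \<alpha>. hl_wt N e \<alpha> \<beta> * (if \<beta> = (\<lambda>_. 0) then 1 else 0))"
    using Cons.IH moves_cols by simp
  also have "\<dots> = (\<Sum>\<beta>\<in>moves N True \<alpha>. if \<beta> = (\<lambda>_. 0) then hl_wt N e \<alpha> \<beta> else 0)"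
    by (intro sum.cong) auto
  also have "\<dots> = (if (\<lambda>_. 0) \<in> moves N True \<alpha> then hl_wt N e \<alpha> (\<lambda>_. 0) else 0)"
    by (simp add: finite_moves)
  also have "(\<lambda>_. 0) \<in> moves N True \<alpha> \<longleftrightarrow> \<alpha> = (\<lambda>_. 0)"
  proof
    assume *: "(\<lambda>_. 0) \<in> moves N True \<alpha>"
    show "\<alpha> = (\<lambda>_. 0)"
    proof
      fix v
      show "\<alpha> v = 0"
        using * cols_nonneg[OF Cons.prems, of v] by (auto simp: moves_def up_cols_def dest!: spec[of _ v])
    qed
  qed (auto simp: moves_def up_cols_def zero_cols)
  finally show ?case by (auto simp: hl_step_zero)
qed simp

text \<open>Each down letter is moved to the front, where it acts on the empty partition and
  disappears; the remaining up letters contribute 1.\<close>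

theorem chain_sum_rectangle:
  assumes "\<forall>e\<in>set es. e \<ge> 1"
  shows "fps_X ^ Suc N dvd chain_sum N (map (Pair True) es @ map (Pair False) fs) (\<lambda>_. 0) -
    (\<Prod>f\<leftarrow>fs. \<Prod>e\<leftarrow>es. macmahon_factor (e + f))"
proof (induction fs)
  case Nil
  then show ?case by (simp add: chain_sum_ups zero_cols)
next
  case (Cons f fs)
  \<comment> \<open>At the empty partition the size factor is 1, so \<open>trunc_eq\<close> is plain
    congruence.\<close>
  have t0: "trunc_eq N (\<lambda>_. 0) g h \<longleftrightarrow> fps_X ^ Suc N dvd g - h" for g h
    by (simp add: trunc_eq_def csize_def)
  define P where "P = (\<Prod>e\<leftarrow>es. macmahon_factor (e + f))"
  have "trunc_eq N (\<lambda>_. 0) (chain_sum N (map (Pair True) es @ (False, f) # map (Pair False) fs) (\<lambda>_. 0))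
     (P * chain_sum N (map (Pair True) es @ map (Pair False) fs) (\<lambda>_. 0))"
    using chain_sum_move_down[OF assms zero_cols] unfolding P_def chain_sum_down_zero .
  moreover have "trunc_eq N (\<lambda>_. 0) (P * chain_sum N (map (Pair True) es @ map (Pair False) fs) (\<lambda>_. 0))
     (P * (\<Prod>f\<leftarrow>fs. \<Prod>e\<leftarrow>es. macmahon_factor (e + f)))"
    using Cons by (intro trunc_eq_mult) (simp add: t0)
  ultimately show ?case
    unfolding t0[symmetric] by (auto dest: trunc_eq_trans simp: P_def)
qed

section \<open>Connected components and diagonals\<close>

definition mono_step :: "(box \<Rightarrow> 'b) \<Rightarrow> box set \<Rightarrow> box \<Rightarrow> box \<Rightarrow> bool" where
  "mono_step f S a b \<longleftrightarrow> a \<in> S \<and> b \<in> S \<and> share_edge a b \<and> f a = f b"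

definition mono_class :: "(box \<Rightarrow> 'b) \<Rightarrow> box set \<Rightarrow> box \<Rightarrow> box set" where
  "mono_class f S x = {y. (mono_step f S)\<^sup>*\<^sup>* x y}"

lemma share_edge_sym: "share_edge a b \<Longrightarrow> share_edge b a"
  by (cases a; cases b) auto

lemma mono_step_sym: "mono_step f S a b \<Longrightarrow> mono_step f S b a"
  by (auto simp: mono_step_def share_edge_sym)

lemma mono_path_sym: "(mono_step f S)\<^sup>*\<^sup>* a b \<Longrightarrow> (mono_step f S)\<^sup>*\<^sup>* b a"
  by (metis (no_types, lifting) mono_step_sym symp_def symp_rtranclp)

lemma mono_path_invariant:
  "(mono_step f S)\<^sup>*\<^sup>* x y \<Longrightarrow> x \<in> S \<Longrightarrow> y \<in> S \<and> f y = f x"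
  by (induction rule: rtranclp_induct) (auto simp: mono_step_def)

lemma mono_class_refl: "x \<in> mono_class f S x"
  by (simp add: mono_class_def)

lemma mono_class_subset: "x \<in> S \<Longrightarrow> mono_class f S x \<subseteq> S"
  by (auto simp: mono_class_def dest: mono_path_invariant)

lemma mono_class_eq: "y \<in> mono_class f S x \<Longrightarrow> mono_class f S y = mono_class f S x"
  unfolding mono_class_def by (auto intro: rtranclp_trans dest: mono_path_sym)

lemma uniform_connected_mono_class:
  assumes "x \<in> S"
  shows "uniform_connected f (mono_class f S x)"
proof -
  let ?E = "\<lambda>a b. a \<in> mono_class f S x \<and> b \<in> mono_class f S x \<and> share_edge a b"
  have path: "?E\<^sup>*\<^sup>* x y" if "(mono_step f S)\<^sup>*\<^sup>* x y" for y
    using that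
  proof (induction rule: rtranclp_induct)
    case (step y z)
    then have "?E y z"
      unfolding mono_class_def mem_Collect_eq by (auto simp: mono_step_def intro: rtranclp.rtrancl_into_rtrancl)
    with step.IH show ?case by (rule rtranclp.rtrancl_into_rtrancl)
  qed simp
  have "symp ?E"
    by (auto simp: symp_def share_edge_sym)
  then have sym: "?E\<^sup>*\<^sup>* y x" if "?E\<^sup>*\<^sup>* x y" for y
    by (rule sympD[OF symp_rtranclp]) (rule that)
  have "?E\<^sup>*\<^sup>* y z" if "y \<in> mono_class f S x" "z \<in> mono_class f S x" for y z
  proof (rule rtranclp_trans)
    show "?E\<^sup>*\<^sup>* y x" using that(1) by (intro sym path) (simp add: mono_class_def)
    show "?E\<^sup>*\<^sup>* x z" using that(2) by (intro path) (simp add: mono_class_def)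
  qed
  then have "edge_connected (mono_class f S x)"
    unfolding edge_connected_def by blast
  moreover have "f y = f x" if "y \<in> mono_class f S x" for y
    using that mono_path_invariant[OF _ assms, of f y] by (simp add: mono_class_def)
  ultimately show ?thesis
    using mono_class_refl[of x f S] unfolding uniform_connected_def by (metis empty_iff)
qed

lemma uniform_connected_subset_mono_class:
  assumes "uniform_connected f D" "D \<subseteq> S" "x \<in> D"
  shows "D \<subseteq> mono_class f S x"
proof
  fix z assume z: "z \<in> D"
  let ?E = "\<lambda>a b. a \<in> D \<and> b \<in> D \<and> share_edge a b"
  have "?E\<^sup>*\<^sup>* x z"
    using assms(1,3) z unfolding uniform_connected_def edge_connected_def by blast
  moreover have "?E a b \<Longrightarrow> mono_step f S a b" for a b
    using assms unfolding mono_step_def uniform_connected_def by blast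
  ultimately have "(mono_step f S)\<^sup>*\<^sup>* x z"
    by (induction rule: rtranclp_induct) (blast intro: rtranclp.rtrancl_into_rtrancl)+
  then show "z \<in> mono_class f S x" by (simp add: mono_class_def)
qed

text \<open>A uniform connected set stays inside the class of any of its boxes, and the class is
  itself uniform and connected. Maximality thus becomes reachability, which admits induction along
  paths.\<close>

lemma maximal_uniform_connected_eq:
  "maximal_uniform_connected f S = mono_class f S ` S"
proof (intro equalityI subsetI)
  fix C assume C: "C \<in> maximal_uniform_connected f S"
  then obtain x where x: "x \<in> C" "x \<in> S"
    by (auto simp: maximal_uniform_connected_def uniform_connected_def)
  have "mono_class f S x = C"
    using C uniform_connected_mono_class[OF x(2)] mono_class_subset[OF x(2)]
      uniform_connected_subset_mono_class[of f C S x] x(1)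
    unfolding maximal_uniform_connected_def by blast
  then show "C \<in> mono_class f S ` S" using x by auto
next
  fix C assume "C \<in> mono_class f S ` S"
  then obtain x where x: "x \<in> S" "C = mono_class f S x" by auto
  have "D = C" if "C \<subseteq> D" "D \<subseteq> S" "uniform_connected f D" for D
    using uniform_connected_subset_mono_class[OF that(3,2)] mono_class_refl[of x f S] x that by blast
  then show "C \<in> maximal_uniform_connected f S"
    using x uniform_connected_mono_class[of x S f] mono_class_subset[of x S f]
    by (auto simp: maximal_uniform_connected_def)
qed

section \<open>Diagonals and their interlacing\<close>

text \<open>Diagonals are numbered so that \<open>d = r\<close> is the main one; the truncated differences make
  \<open>(k + (r - d), k + (d - r))\<close> the \<open>k\<close>-th box of diagonal \<open>d\<close> on either side of it.\<close>

definition diag_box :: "nat \<Rightarrow> nat \<Rightarrow> nat \<Rightarrow> box" where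
  "diag_box r d k = (k + (r - d), k + (d - r))"

definition diag_cols :: "nat \<Rightarrow> (nat \<Rightarrow> nat \<Rightarrow> nat) \<Rightarrow> nat \<Rightarrow> nat \<Rightarrow> int" where
  "diag_cols r \<pi> d v = int (card {k. 1 \<le> k \<and> v < case_prod \<pi> (diag_box r d k)})"

definition bounded_pps :: "nat \<Rightarrow> nat \<Rightarrow> nat \<Rightarrow> (nat \<Rightarrow> nat \<Rightarrow> nat) set" where
  "bounded_pps r c N = {\<pi> \<in> plane_partitions_in r c. \<forall>i j. \<pi> i j \<le> N}"

locale pp_diagonals =
  fixes r c N :: nat and \<pi> :: "nat \<Rightarrow> nat \<Rightarrow> nat"
  assumes pp: "\<pi> \<in> bounded_pps r c N"
begin

abbreviation "C \<equiv> diag_cols r \<pi>"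
abbreviation "bx \<equiv> diag_box r"
abbreviation "val b \<equiv> case_prod \<pi> b"

lemma decr_right: "1 \<le> i \<Longrightarrow> 1 \<le> j \<Longrightarrow> \<pi> i (Suc j) \<le> \<pi> i j"
  and decr_down: "1 \<le> i \<Longrightarrow> 1 \<le> j \<Longrightarrow> \<pi> (Suc i) j \<le> \<pi> i j"
  and zero_left: "\<pi> 0 j = 0" "\<pi> i 0 = 0"
  and outside: "i > r \<or> j > c \<Longrightarrow> \<pi> i j = 0"
  and bound: "\<pi> i j \<le> N"
  and finite_support: "finite (support \<pi>)"
  using pp by (auto simp: bounded_pps_def plane_partitions_in_def plane_partitions_def)

lemma decr_diag:
  assumes "1 \<le> i" "1 \<le> j" shows "\<pi> (i + h) (j + h) \<le> \<pi> i j"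
proof (induction h)
  case (Suc h)
  have "\<pi> (i + Suc h) (j + Suc h) \<le> \<pi> (i + h) (j + Suc h)"
    using decr_down[of "i + h" "j + Suc h"] assms by simp
  also have "\<dots> \<le> \<pi> (i + h) (j + h)"
    using decr_right[of "i + h" "j + h"] assms by simp
  finally show ?case using Suc by simp
qed simp

lemma val_bx_antimono:
  assumes "1 \<le> k" "k \<le> l" shows "val (bx d l) \<le> val (bx d k)"
  using decr_diag[of "k + (r - d)" "k + (d - r)" "l - k"] assms by (simp add: diag_box_def add_ac)

text \<open>Entries weakly decrease along a diagonal, so the positions with entry above
  \<open>v\<close> form an initial segment starting at 1, and its size decides membership. This is
  the dictionary between entries and column lengths.\<close>

lemma galois:
  assumes "1 \<le> k"
  shows "v < val (bx d k) \<longleftrightarrow> int k \<le> C d v"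
proof -
  define A where "A = {k. 1 \<le> k \<and> v < val (bx d k)}"
  have "A \<subseteq> {..r}"
  proof
    fix k assume "k \<in> A"
    then have "\<not> k + (r - d) > r" using outside[of "k + (r - d)" "k + (d - r)"]
      by (auto simp: A_def diag_box_def)
    then show "k \<in> {..r}" by simp
  qed
  then have fin: "finite A" by (rule finite_subset) simp
  have down: "l \<in> A" if "k \<in> A" "1 \<le> l" "l \<le> k" for k l
    using that val_bx_antimono[of l k d] by (auto simp: A_def)
  have "A = {1..card A}"
  proof (cases "A = {}")
    case False
    define m where "m = Max A"
    have "A = {1..m}"
    proof (intro equalityI subsetI)
      fix l assume "l \<in> A"
      then show "l \<in> {1..m}" using Max_ge[OF fin] by (simp add: m_def A_def)
    next
      fix l assume "l \<in> {1..m}"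
      then show "l \<in> A" using down[of m l] Max_in[OF fin False] by (simp add: m_def)
    qed
    then show ?thesis by simp
  qed simp
  then have "k \<in> A \<longleftrightarrow> k \<le> card A" using assms by (metis atLeastAtMost_iff)
  then show ?thesis using assms by (simp add: A_def diag_cols_def)
qed

lemma C_nonneg: "0 \<le> C d v"
  by (simp add: diag_cols_def)

lemma C_leI:
  assumes "\<And>k. 1 \<le> k \<Longrightarrow> v < val (bx d k) \<Longrightarrow> int k \<le> b" "0 \<le> b"
  shows "C d v \<le> b"
proof (cases "C d v \<ge> 1")
  case True
  then show ?thesis using assms(1)[of "nat (C d v)"] galois[of "nat (C d v)" v d] by simp
qed (use assms in simp)

lemma C_decr: "C d (Suc v) \<le> C d v"
  by (intro C_leI C_nonneg) (simp add: galois[symmetric])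

lemma C_zero_value: "N \<le> v \<Longrightarrow> C d v = 0"
proof (rule antisym[OF C_leI C_nonneg])
  fix k assume "N \<le> v" "v < val (bx d k)"
  then show "int k \<le> 0"
    using bound[of "k + (r - d)" "k + (d - r)"] by (simp add: diag_box_def)
qed simp

lemma C_cols: "C d \<in> cols N"
  by (simp add: cols_def C_decr C_zero_value)

text \<open>Diagonal 0 begins below row \<open>r\<close>, and the diagonals from
  \<open>r + c\<close> on begin to the right of column \<open>c\<close>.\<close>

lemma C_zero_diag:
  assumes "d = 0 \<or> r + c \<le> d" shows "C d v = 0"
proof (rule antisym[OF C_leI C_nonneg])
  fix k assume "1 \<le> k" "v < val (bx d k)"
  moreover have "r < k + (r - d) \<or> c < k + (d - r)" using \<open>1 \<le> k\<close> assms by auto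
  ultimately show "int k \<le> 0" using outside by (auto simp: diag_box_def)
qed simp

text \<open>Before the main diagonal, the \<open>k\<close>-th box of \<open>Suc d\<close> lies
  directly above the \<open>k\<close>-th box of \<open>d\<close> and directly to the right of the
  one numbered \<open>k - 1\<close>. Monotonicity in the two directions gives the two
  bounds.\<close>

lemma C_up:
  assumes "d < r" shows "C (Suc d) v - C d v \<in> {0, 1}"
proof -
  obtain a where r: "r = Suc d + a" using assms less_iff_Suc_add[of d r] by auto
  have "C d v \<le> C (Suc d) v"
  proof (intro C_leI C_nonneg)
    fix k assume k: "1 \<le> k" "v < val (bx d k)"
    then have "v < val (bx (Suc d) k)"
      using decr_down[of "k + a" k] by (simp add: diag_box_def r)
    then show "int k \<le> C (Suc d) v" using galois k by simp
  qed
  moreover have "C (Suc d) v \<le> C d v + 1"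
  proof (intro C_leI)
    fix k assume k: "1 \<le> k" "v < val (bx (Suc d) k)"
    then obtain l where l: "k = Suc l" by (cases k) auto
    show "int k \<le> C d v + 1"
    proof (cases "l = 0")
      case True
      then show ?thesis using C_nonneg[of d v] l by simp
    next
      case False
      then have "v < val (bx d l)"
        using k decr_right[of "k + a" l] by (simp add: diag_box_def r l)
      then show ?thesis using galois[of l v d] False l by simp
    qed
  qed (use C_nonneg[of d v] in simp)
  ultimately show ?thesis by auto
qed

text \<open>The transposed argument: the \<open>k\<close>-th box of \<open>d\<close> lies directly
  to the left of the \<open>k\<close>-th box of \<open>Suc d\<close> and directly below the one
  numbered \<open>k - 1\<close>.\<close>

lemma C_down:
  assumes "r \<le> d" shows "C d v - C (Suc d) v \<in> {0, 1}"
proof -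
  obtain a where r: "d = r + a" using assms le_Suc_ex by blast
  have "C (Suc d) v \<le> C d v"
  proof (intro C_leI C_nonneg)
    fix k assume k: "1 \<le> k" "v < val (bx (Suc d) k)"
    then have "v < val (bx d k)"
      using decr_right[of k "k + a"] by (simp add: diag_box_def r)
    then show "int k \<le> C d v" using galois k by simp
  qed
  moreover have "C d v \<le> C (Suc d) v + 1"
  proof (intro C_leI)
    fix k assume k: "1 \<le> k" "v < val (bx d k)"
    then obtain l where l: "k = Suc l" by (cases k) auto
    show "int k \<le> C (Suc d) v + 1"
    proof (cases "l = 0")
      case True
      then show ?thesis using C_nonneg[of "Suc d" v] l by simp
    next
      case False
      then have "v < val (bx (Suc d) l)"
        using k decr_down[of l "k + a"] by (simp add: diag_box_def r l)
      then show ?thesis using galois[of l v "Suc d"] False l by simp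
    qed
  qed (use C_nonneg[of "Suc d" v] in simp)
  ultimately show ?thesis by auto
qed

lemma C_moves: "C (Suc d) \<in> moves N (d < r) (C d)"
  using C_up[of d] C_down[of d] C_cols by (auto simp: moves_def up_cols_def dn_cols_def)

end

section \<open>Levels and border components along diagonals\<close>

context pp_diagonals begin

text \<open>The level with membership in the component replaced by equality of values;
  \<open>class_diag\<close> makes the two agree.\<close>

definition lev :: "box \<Rightarrow> nat" where
  "lev = (\<lambda>(i, j). LEAST h. 0 < h \<and> \<pi> (i + h) (j + h) \<noteq> \<pi> i j)"

definition diag :: "box \<Rightarrow> nat" where
  "diag = (\<lambda>(i, j). j + r - i)"

text \<open>Every border component is a path that meets each diagonal at most once, so it is determined by its
  first box.\<close>

definition starts :: "box set" where
  "starts = {b \<in> support \<pi>. \<nexists>a. mono_step (\<lambda>x. (val x, lev x)) (support \<pi>) b a \<and> Suc (diag a) = diag b}"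

lemma startsD: "b \<in> starts \<Longrightarrow> mono_step (\<lambda>x. (val x, lev x)) (support \<pi>) b a \<Longrightarrow> Suc (diag a) \<noteq> diag b"
  unfolding starts_def by blast

text \<open>The multiplicity of the value \<open>Suc v\<close> on diagonal \<open>d\<close>.\<close>

abbreviation (input) "mlt d v \<equiv> C d v - C d (Suc v)"

lemma diag_bx: "diag (bx d k) = d"
  by (simp add: diag_def diag_box_def)

lemma val_bx_eq:
  assumes "1 \<le> k"
  shows "val (bx d k) = Suc v \<longleftrightarrow> C d (Suc v) < int k \<and> int k \<le> C d v"
  using galois[OF assms, of v d] galois[OF assms, of "Suc v" d] by auto

lemma bx_support: "1 \<le> k \<Longrightarrow> bx d k \<in> support \<pi> \<longleftrightarrow> val (bx d k) > 0"
  by (simp add: support_def diag_box_def)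

text \<open>Diagonal 0 is empty, so a box of the support lies on a successor diagonal; this form
  attaches it to the step from \<open>d\<close> to \<open>Suc d\<close>.\<close>

lemma supportE:
  assumes "b \<in> support \<pi>"
  obtains d k v where "b = bx (Suc d) k" "d < r + c" "v < N" "1 \<le> k" "val b = Suc v"
    "C (Suc d) (Suc v) < int k" "int k \<le> C (Suc d) v"
proof -
  obtain i j where b: "b = (i, j)" by fastforce
  have ij: "1 \<le> i" "1 \<le> j" "\<pi> i j > 0" "i \<le> r"
    using assms outside[of i j] by (auto simp: b support_def not_less[symmetric])
  define D k where "D = j + r - i" and "k = min i j"
  have k: "1 \<le> k" using ij by (simp add: k_def)
  have bx: "b = bx D k"
    using ij by (auto simp: b diag_box_def D_def k_def min_def)
  obtain d where d: "D = Suc d" using ij by (cases D) (auto simp: D_def)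
  obtain v where v: "val b = Suc v" using ij b by (cases "\<pi> i j") auto
  have C: "C (Suc d) (Suc v) < int k" "int k \<le> C (Suc d) v"
    using val_bx_eq[OF k, of "Suc d" v] v bx d by auto
  have "\<not> r + c \<le> Suc d" using C k C_zero_diag[of "Suc d" v] by auto
  moreover have "v < N" using bound[of i j] v b by simp
  ultimately show ?thesis using that bx d k v C by simp
qed

text \<open>The value \<open>Suc v\<close> fills a block of consecutive positions ending at
  \<open>C d v\<close>, and the level counts positions from that end, starting at 1.\<close>

lemma lev_bx:
  assumes "1 \<le> k" "C d (Suc v) < int k" "int k \<le> C d v"
  shows "int (lev (bx d k)) = C d v - int k + 1"
proof -
  have v: "val (bx d k) = Suc v" using val_bx_eq assms by simp
  have "lev (bx d k) = (LEAST h. 0 < h \<and> val (bx d (k + h)) \<noteq> Suc v)"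
    using v by (simp add: lev_def diag_box_def add_ac)
  also have "\<dots> = (LEAST h. 0 < h \<and> C d v < int (k + h))"
  proof -
    have "val (bx d (k + h)) \<noteq> Suc v \<longleftrightarrow> C d v < int (k + h)" for h
      using val_bx_eq[of "k + h" d v] assms by auto
    then show ?thesis by simp
  qed
  also have "\<dots> = nat (C d v - int k + 1)"
    by (rule Least_equality) (use assms in auto)
  finally show ?thesis using assms by simp
qed

lemma lev_pos: "b \<in> support \<pi> \<Longrightarrow> 1 \<le> lev b"
proof (erule supportE)
  fix d k v assume b: "b = bx (Suc d) k" and k: "1 \<le> k" "C (Suc d) (Suc v) < int k" "int k \<le> C (Suc d) v"
  show "1 \<le> lev b" unfolding b using lev_bx[OF k] k(3) by linarith
qed

text \<open>If the values at the two ends of a diagonal segment agree, monotonicity squeezes all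
  boxes on it and the boxes just right of them to the same value; these form a connecting
  path.\<close>

lemma class_diag:
  assumes "x \<in> support \<pi>" "(i, j) \<in> mono_class (case_prod \<pi>) (support \<pi>) x"
  shows "(i + h, j + h) \<in> mono_class (case_prod \<pi>) (support \<pi>) x \<longleftrightarrow> \<pi> (i + h) (j + h) = \<pi> i j"
proof
  have ij: "(i, j) \<in> support \<pi>" using assms mono_class_subset by blast
  then have p: "1 \<le> i" "1 \<le> j" "0 < \<pi> i j" by (auto simp: support_def)
  have val: "\<pi> a b = case_prod \<pi> x" if "(a, b) \<in> mono_class (case_prod \<pi>) (support \<pi>) x" for a b
    using that mono_path_invariant[of "case_prod \<pi>" "support \<pi>" x "(a, b)"] assms(1) by (simp add: mono_class_def)
  {
    assume "(i + h, j + h) \<in> mono_class (case_prod \<pi>) (support \<pi>) x"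
    then show "\<pi> (i + h) (j + h) = \<pi> i j" using val assms(2) by simp
  }
  show "\<pi> (i + h) (j + h) = \<pi> i j \<Longrightarrow> (i + h, j + h) \<in> mono_class (case_prod \<pi>) (support \<pi>) x"
  proof (induction h)
    case (Suc h)
    have 1: "\<pi> (i + Suc h) (j + Suc h) \<le> \<pi> (i + h) (j + Suc h)"
      using decr_down[of "i + h" "j + Suc h"] p by simp
    have 2: "\<pi> (i + h) (j + Suc h) \<le> \<pi> (i + h) (j + h)"
      using decr_right[of "i + h" "j + h"] p by simp
    have 3: "\<pi> (i + h) (j + h) \<le> \<pi> i j" using decr_diag p by simp
    have e: "\<pi> (i + h) (j + h) = \<pi> i j" "\<pi> (i + h) (j + Suc h) = \<pi> i j"
      using 1 2 3 Suc.prems by simp_all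
    have "mono_step (case_prod \<pi>) (support \<pi>) (i + h, j + h) (i + h, j + Suc h)"
      "mono_step (case_prod \<pi>) (support \<pi>) (i + h, j + Suc h) (i + Suc h, j + Suc h)"
      using e Suc.prems p by (auto simp: mono_step_def support_def)
    then show ?case
      using Suc.IH[OF e(1)] unfolding mono_class_def mem_Collect_eq
      by (meson rtranclp.rtrancl_into_rtrancl)
  qed (use assms in simp)
qed

lemma level_eq_lev:
  assumes "x \<in> support \<pi>" "b \<in> mono_class (case_prod \<pi>) (support \<pi>) x"
  shows "level (mono_class (case_prod \<pi>) (support \<pi>) x) b = lev b"
  using class_diag[OF assms(1)] assms(2) by (cases b) (simp add: level_def lev_def)

text \<open>A move that preserves value and level never leaves the component, and inside it
  \<open>level K\<close> is \<open>lev\<close>. So the border components of all components become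
  classes for one label on the whole support.\<close>

lemma border_components_eq:
  assumes "x \<in> support \<pi>" "K = mono_class (case_prod \<pi>) (support \<pi>) x"
  shows "border_components K = mono_class (\<lambda>x. (val x, lev x)) (support \<pi>) ` K"
proof -
  have K: "K \<subseteq> support \<pi>" using assms mono_class_subset by blast
  have lv: "level K b = lev b" if "b \<in> K" for b using assms level_eq_lev that by simp
  have val: "val b = val x" if "b \<in> K" for b
    using that mono_path_invariant[of "case_prod \<pi>" "support \<pi>" x b] assms by (simp add: mono_class_def)
  have "mono_class (level K) K y = mono_class (\<lambda>x. (val x, lev x)) (support \<pi>) y" if y: "y \<in> K" for y
  proof -
    have 1: "(mono_step (\<lambda>x. (val x, lev x)) (support \<pi>))\<^sup>*\<^sup>* y z" if "(mono_step (level K) K)\<^sup>*\<^sup>* y z" for z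
      using that
    proof (induction rule: rtranclp_induct)
      case (step a b)
      have ab: "a \<in> K" "b \<in> K" "share_edge a b" "level K a = level K b"
        using step.hyps by (auto simp: mono_step_def)
      have "mono_step (\<lambda>x. (val x, lev x)) (support \<pi>) a b"
        unfolding mono_step_def using ab lv[OF ab(1)] lv[OF ab(2)] val[OF ab(1)] val[OF ab(2)] K by auto
      with step.IH show ?case by (rule rtranclp.rtrancl_into_rtrancl)
    qed simp
    have 2: "(mono_step (level K) K)\<^sup>*\<^sup>* y z \<and> z \<in> K"
      if "(mono_step (\<lambda>x. (val x, lev x)) (support \<pi>))\<^sup>*\<^sup>* y z" for z
      using that
    proof (induction rule: rtranclp_induct)
      case (step a b)
      have ab: "a \<in> K" "share_edge a b" "val a = val b" "lev a = lev b" "a \<in> support \<pi>" "b \<in> support \<pi>"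
        using step by (auto simp: mono_step_def)
      have "mono_step (case_prod \<pi>) (support \<pi>) a b"
        using ab by (simp add: mono_step_def)
      then have b: "b \<in> K"
        using ab(1) unfolding assms(2) mono_class_def mem_Collect_eq
        by (meson rtranclp.rtrancl_into_rtrancl)
      have "mono_step (level K) K a b"
        unfolding mono_step_def using ab b lv[OF ab(1)] lv[OF b] by auto
      with step.IH b show ?case by (meson rtranclp.rtrancl_into_rtrancl)
    qed (use y in simp)
    show ?thesis unfolding mono_class_def using 1 2 by blast
  qed
  then show ?thesis by (simp add: border_components_def maximal_uniform_connected_eq)
qed

lemma share_edge_diag:
  assumes "a \<in> support \<pi>" "b \<in> support \<pi>" "share_edge a b"
  shows "diag a = Suc (diag b) \<or> diag b = Suc (diag a)"
proof -
  obtain i j where a: "a = (i, j)" by fastforce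
  obtain k l where b: "b = (k, l)" by fastforce
  have "i \<le> r" "k \<le> r"
    using assms outside[of i j] outside[of k l] by (auto simp: a b support_def not_less[symmetric])
  then show ?thesis using assms(3) by (auto simp: a b diag_def)
qed

lemma box_determined:
  assumes "a \<in> support \<pi>" "b \<in> support \<pi>" "diag a = diag b" "val a = val b" "lev a = lev b"
  shows "a = b"
proof -
  obtain d k v where a: "a = bx (Suc d) k" "1 \<le> k" "val a = Suc v"
    "C (Suc d) (Suc v) < int k" "int k \<le> C (Suc d) v"
    using assms(1) by (elim supportE)
  obtain d' k' v' where b: "b = bx (Suc d') k'" "1 \<le> k'" "val b = Suc v'"
    "C (Suc d') (Suc v') < int k'" "int k' \<le> C (Suc d') v'"
    using assms(2) by (elim supportE)
  have d: "d' = d" using assms(3) by (simp add: a(1) b(1) diag_bx)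
  have v: "v' = v" using assms(4) a(3) b(3) by simp
  have "int (lev a) = C (Suc d) v - int k + 1"
    unfolding a(1) by (rule lev_bx[OF a(2,4,5)])
  moreover have "int (lev b) = C (Suc d') v' - int k' + 1"
    unfolding b(1) by (rule lev_bx[OF b(2,4,5)])
  ultimately have "k = k'" using assms(5) unfolding d v by linarith
  then show ?thesis unfolding a(1) b(1) d by (rule arg_cong)
qed

text \<open>Each move changes the diagonal by one, and a class has at most one box per diagonal. To
  reach a smaller diagonal a path would have to return to the start \<open>b\<close>, which has no
  neighbour in its class on the previous diagonal.\<close>

lemma class_starts:
  assumes "b \<in> starts" "(mono_step (\<lambda>x. (val x, lev x)) (support \<pi>))\<^sup>*\<^sup>* b y"
  shows "diag b \<le> diag y"
  using assms(2)
proof (induction rule: rtranclp_induct)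
  case (step y z)
  have b: "b \<in> support \<pi>" using assms(1) by (simp add: starts_def)
  have yz: "y \<in> support \<pi>" "z \<in> support \<pi>" "share_edge y z"
    using step by (auto simp: mono_step_def)
  have same: "val y = val b" "lev y = lev b"
    using mono_path_invariant[OF step.hyps(1) b] by auto
  show ?case
  proof (cases "diag y = diag b")
    case True
    then have "y = b" using box_determined[OF yz(1) b] same by simp
    then show ?thesis
      using startsD[OF assms(1), of z] step.hyps(2) share_edge_diag[OF yz] by auto
  next
    case False
    then show ?thesis using step.IH share_edge_diag[OF yz] by auto
  qed
qed simp

lemma starts_unique:
  assumes "a \<in> starts" "b \<in> starts" "b \<in> mono_class (\<lambda>x. (val x, lev x)) (support \<pi>) a"
  shows "a = b"
proof -
  have path: "(mono_step (\<lambda>x. (val x, lev x)) (support \<pi>))\<^sup>*\<^sup>* a b"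
    using assms(3) by (simp add: mono_class_def)
  have s: "a \<in> support \<pi>" "b \<in> support \<pi>" using assms by (auto simp: starts_def)
  have "diag a = diag b"
    using class_starts[OF assms(1) path] class_starts[OF assms(2) mono_path_sym[OF path]] by simp
  then show ?thesis
    using box_determined[OF s] mono_path_invariant[OF path s(1)] by auto
qed

lemma starts_exists:
  assumes "x \<in> support \<pi>"
  shows "\<exists>b\<in>starts. b \<in> mono_class (\<lambda>x. (val x, lev x)) (support \<pi>) x"
proof -
  let ?B = "mono_class (\<lambda>x. (val x, lev x)) (support \<pi>) x"
  have "x \<in> ?B" by (rule mono_class_refl)
  then obtain b where b: "b \<in> ?B" "\<And>y. y \<in> ?B \<Longrightarrow> diag b \<le> diag y"
    using ex_has_least_nat[of "\<lambda>y. y \<in> ?B" x diag] by blast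
  have "a \<in> ?B" if "mono_step (\<lambda>x. (val x, lev x)) (support \<pi>) b a" for a
    using b(1) that unfolding mono_class_def mem_Collect_eq by (rule rtranclp.rtrancl_into_rtrancl)
  then have "Suc (diag a) \<noteq> diag b" if "mono_step (\<lambda>x. (val x, lev x)) (support \<pi>) b a" for a
    using b(2)[of a] that by fastforce
  moreover have "b \<in> support \<pi>" using b(1) mono_class_subset[OF assms] by blast
  ultimately have "b \<in> starts" unfolding starts_def by blast
  then show ?thesis using b(1) by blast
qed

text \<open>Each border component contains exactly one start, of the same level, so the factors can
  be indexed by starts and grouped by level.\<close>

lemma component_poly_eq:
  assumes "x \<in> support \<pi>" "K = mono_class (case_prod \<pi>) (support \<pi>) x"
  shows "component_poly K = (\<Prod>b\<in>K \<inter> starts. 1 - tvar ^ lev b)"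
proof -
  let ?G = "mono_class (\<lambda>x. (val x, lev x)) (support \<pi>)"
  have K: "K \<subseteq> support \<pi>" using assms mono_class_subset by blast
  then have finK: "finite K" using finite_support finite_subset by blast
  have lv: "level K b = lev b" if "b \<in> K" for b using assms level_eq_lev that by simp
  have GK: "?G b \<subseteq> K" if "b \<in> K" for b
  proof -
    have "?G b \<in> border_components K" using that border_components_eq[OF assms] by blast
    then show ?thesis by (auto simp: border_components_def maximal_uniform_connected_def)
  qed
  have lG: "lev y = lev b" if "y \<in> ?G b" "b \<in> K" for y b
    using that K mono_path_invariant[of "\<lambda>x. (val x, lev x)" "support \<pi>" b y] by (auto simp: mono_class_def)
  have num: "num_border_components K i = card {b \<in> K \<inter> starts. lev b = i}" for i
  proof -
    have "bij_betw ?G {b \<in> K \<inter> starts. lev b = i} {B \<in> border_components K. \<forall>b\<in>B. level K b = i}"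
    proof (rule bij_betwI')
      fix a b assume "a \<in> {b \<in> K \<inter> starts. lev b = i}" "b \<in> {b \<in> K \<inter> starts. lev b = i}"
      then have st: "a \<in> starts" "b \<in> starts" by simp_all
      have "a = b" if "?G a = ?G b"
        by (rule starts_unique[OF st]) (use that mono_class_refl in simp)
      then show "(?G a = ?G b) = (a = b)" by blast
    next
      fix b assume b: "b \<in> {b \<in> K \<inter> starts. lev b = i}"
      then have bK: "b \<in> K" by simp
      have "level K y = i" if "y \<in> ?G b" for y
        using lv[of y] lG[OF that bK] GK[OF bK] that b by auto
      then show "?G b \<in> {B \<in> border_components K. \<forall>b\<in>B. level K b = i}"
        unfolding border_components_eq[OF assms] using bK by blast
    next
      fix B assume B: "B \<in> {B \<in> border_components K. \<forall>b\<in>B. level K b = i}"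
      then obtain y where y: "y \<in> K" "B = ?G y"
        using border_components_eq[OF assms] by auto
      obtain b where b: "b \<in> starts" "b \<in> ?G y" using starts_exists[of y] y K by blast
      have "b \<in> K" using GK[OF y(1)] b(2) by blast
      moreover have "lev b = i" using B b(2) lv[OF \<open>b \<in> K\<close>] unfolding y(2) by simp
      moreover have "B = ?G b" using mono_class_eq[OF b(2)] y by simp
      ultimately show "\<exists>b\<in>{b \<in> K \<inter> starts. lev b = i}. B = ?G b" using b by blast
    qed
    then show ?thesis unfolding num_border_components_def by (simp add: bij_betw_same_card)
  qed
  have "component_poly K = (\<Prod>i | 1 \<le> i \<and> num_border_components K i \<noteq> 0.
     \<Prod>b | b \<in> K \<inter> starts \<and> lev b = i. 1 - tvar ^ lev b)"
    unfolding component_poly_def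
  proof (rule prod.cong[OF refl])
    fix i
    have "(\<Prod>b | b \<in> K \<inter> starts \<and> lev b = i. 1 - tvar ^ lev b) = (\<Prod>b | b \<in> K \<inter> starts \<and> lev b = i. 1 - tvar ^ i)"
      by (rule prod.cong) auto
    then show "(1 - tvar ^ i) ^ num_border_components K i = (\<Prod>b | b \<in> K \<inter> starts \<and> lev b = i. 1 - tvar ^ lev b)"
      using num[of i] by simp
  qed
  also have "\<dots> = (\<Prod>b\<in>K \<inter> starts. 1 - tvar ^ lev b)"
  proof (rule prod.group)
    show "finite (K \<inter> starts)" using finK by simp
    show "finite {i. 1 \<le> i \<and> num_border_components K i \<noteq> 0}" using finite_border_levels[OF finK] .
    show "lev ` (K \<inter> starts) \<subseteq> {i. 1 \<le> i \<and> num_border_components K i \<noteq> 0}"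
    proof
      fix i assume "i \<in> lev ` (K \<inter> starts)"
      then obtain b where b: "b \<in> K" "b \<in> starts" "i = lev b" by blast
      have "1 \<le> i" using lev_pos[of b] K b by blast
      moreover have "{a \<in> K \<inter> starts. lev a = i} \<noteq> {}" using b by blast
      then have "num_border_components K i \<noteq> 0" using num[of i] finK by simp
      ultimately show "i \<in> {i. 1 \<le> i \<and> num_border_components K i \<noteq> 0}" by simp
    qed
  qed
  finally show ?thesis .
qed

lemma pp_weight_starts: "pp_weight \<pi> = (\<Prod>b\<in>starts. 1 - tvar ^ lev b)"
proof -
  let ?F = "mono_class (case_prod \<pi>) (support \<pi>)"
  have cc: "connected_components_pp \<pi> = ?F ` support \<pi>"
    by (simp add: connected_components_pp_def maximal_uniform_connected_eq)
  have fin: "finite starts" using finite_support by (simp add: starts_def)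
  have "pp_weight \<pi> = (\<Prod>K\<in>?F ` support \<pi>. \<Prod>b | b \<in> starts \<and> ?F b = K. 1 - tvar ^ lev b)"
    unfolding pp_weight_def cc
  proof (rule prod.cong[OF refl])
    fix K assume "K \<in> ?F ` support \<pi>"
    then obtain x where x: "x \<in> support \<pi>" "K = ?F x" by auto
    have "K \<inter> starts = {b \<in> starts. ?F b = K}"
      unfolding x(2)
    proof (intro equalityI subsetI)
      fix b assume "b \<in> ?F x \<inter> starts"
      then show "b \<in> {b \<in> starts. ?F b = ?F x}"
        using mono_class_eq[of b "case_prod \<pi>" "support \<pi>" x] by simp
    next
      fix b assume "b \<in> {b \<in> starts. ?F b = ?F x}"
      then show "b \<in> ?F x \<inter> starts"
        using mono_class_refl[of b "case_prod \<pi>" "support \<pi>"] by simp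
    qed
    then show "component_poly K = (\<Prod>b | b \<in> starts \<and> ?F b = K. 1 - tvar ^ lev b)"
      using component_poly_eq[OF x] by simp
  qed
  also have "\<dots> = (\<Prod>b\<in>starts. 1 - tvar ^ lev b)"
    by (rule prod.group) (use fin finite_support in \<open>auto simp: starts_def\<close>)
  finally show ?thesis .
qed

section \<open>Starts as increases of multiplicity\<close>

lemma mlt_Suc_le: "mlt (Suc d) v \<le> mlt d v + 1"
  using C_up[of d v] C_up[of d "Suc v"] C_down[of d v] C_down[of d "Suc v"] by (cases "d < r") auto

text \<open>The hypothesis says that both positions are equally far from \<open>C (Suc d) v\<close>
  and \<open>C d v\<close>, which is equality of levels. Interlacing leaves two relative positions,
  both adjacent.\<close>

lemma bx_adjacent:
  assumes "int k' = int k + C d v - C (Suc d) v"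
  shows "share_edge (bx (Suc d) k) (bx d k')"
proof (cases "d < r")
  case True
  then obtain a where r: "r = Suc d + a" using less_iff_Suc_add[of d r] by auto
  have "k' = k \<or> k = Suc k'" using assms C_up[OF True, of v] by auto
  then show ?thesis by (auto simp: diag_box_def r)
next
  case False
  then obtain a where r: "d = r + a" using le_Suc_ex[of r d] by auto
  have "k' = k \<or> k' = Suc k" using assms C_down[of d v] False by auto
  then show ?thesis by (auto simp: diag_box_def r)
qed

text \<open>The previous diagonal has a box of the same value and level iff the multiplicity there
  reaches this level, and that box is then a neighbour by \<open>bx_adjacent\<close>.\<close>

lemma starts_iff:
  assumes "1 \<le> k" "C (Suc d) (Suc v) < int k" "int k \<le> C (Suc d) v"
  shows "bx (Suc d) k \<in> starts \<longleftrightarrow> mlt d v < int (lev (bx (Suc d) k))"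
proof
  let ?b = "bx (Suc d) k"
  have lb: "int (lev ?b) = C (Suc d) v - int k + 1" by (rule lev_bx[OF assms])
  have vb: "val ?b = Suc v" using val_bx_eq assms by simp
  have sb: "?b \<in> support \<pi>" using bx_support[OF assms(1)] vb by simp
  {
    assume st: "?b \<in> starts"
    show "mlt d v < int (lev ?b)"
    proof (rule ccontr)
      assume *: "\<not> mlt d v < int (lev ?b)"
      \<comment> \<open>The position on diagonal \<open>d\<close> with the same value and level as
        \<open>?b\<close>.\<close>
      define k' where "k' = nat (int k + C d v - C (Suc d) v)"
      have k': "C d (Suc v) < int k'" "int k' \<le> C d v" "1 \<le> k'" "int k' = int k + C d v - C (Suc d) v"
        using * lb assms C_nonneg[of d "Suc v"] by (auto simp: k'_def)
      have "val (bx d k') = Suc v" using val_bx_eq k' by simp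
      moreover have "bx d k' \<in> support \<pi>" using bx_support[OF k'(3)] calculation by simp
      moreover have "lev (bx d k') = lev ?b" using lev_bx[OF k'(3,1,2)] lb k'(4) by simp
      ultimately have "mono_step (\<lambda>x. (val x, lev x)) (support \<pi>) ?b (bx d k')"
        using sb vb bx_adjacent[OF k'(4)] by (simp add: mono_step_def)
      then show False using startsD[OF st, of "bx d k'"] by (simp add: diag_bx)
    qed
  }
  assume *: "mlt d v < int (lev ?b)"
  have False if a: "mono_step (\<lambda>x. (val x, lev x)) (support \<pi>) ?b a" "Suc (diag a) = diag ?b" for a
  proof -
    have "a \<in> support \<pi>" "val a = Suc v" "lev a = lev ?b" using a vb by (auto simp: mono_step_def)
    then obtain d' k' where k': "a = bx (Suc d') k'" "1 \<le> k'" "C (Suc d') (Suc v) < int k'" "int k' \<le> C (Suc d') v"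
      by (elim supportE) simp
    have "Suc d' = d" using a(2) by (simp add: k'(1) diag_bx)
    then show False using lev_bx[OF k'(2-4)] \<open>lev a = lev ?b\<close> * k' by simp
  qed
  then show "?b \<in> starts" using sb unfolding starts_def by blast
qed

text \<open>A multiplicity rises by at most one per step, so a rise creates exactly one start, whose
  level is the new multiplicity. All other pairs contribute the factor 1.\<close>

theorem pp_weight_eq:
  "pp_weight \<pi> = (\<Prod>d<r + c. \<Prod>v<N. hl_factor tvar (mlt d v) (mlt (Suc d) v))"
proof -
  define A where "A = {(d, v). d < r + c \<and> v < N \<and> mlt d v < mlt (Suc d) v}"
  have finA: "finite A" by (rule finite_subset[of _ "{..<r + c} \<times> {..<N}"]) (auto simp: A_def)
  \<comment> \<open>The first position of the value \<open>Suc v\<close> on the diagonal; its level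
    is the full multiplicity.\<close>
  define top where "top = (\<lambda>(d, v). bx (Suc d) (Suc (nat (C (Suc d) (Suc v)))))"
  have tp: "val (top (d, v)) = Suc v" "diag (top (d, v)) = Suc d" "top (d, v) \<in> starts"
    "int (lev (top (d, v))) = mlt (Suc d) v" if "(d, v) \<in> A" for d v
  proof -
    define k where "k = Suc (nat (C (Suc d) (Suc v)))"
    have t: "top (d, v) = bx (Suc d) k" by (simp add: top_def k_def)
    have m: "mlt d v < mlt (Suc d) v" using that by (simp add: A_def)
    have k: "1 \<le> k" "C (Suc d) (Suc v) < int k" "int k \<le> C (Suc d) v" "int k = C (Suc d) (Suc v) + 1"
      using C_nonneg[of "Suc d" "Suc v"] C_decr[of d v] m by (auto simp: k_def)
    show "val (top (d, v)) = Suc v" using val_bx_eq k t by simp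
    show "diag (top (d, v)) = Suc d" by (simp add: t diag_bx)
    show "int (lev (top (d, v))) = mlt (Suc d) v" using lev_bx[OF k(1-3)] k(4) t by simp
    then show "top (d, v) \<in> starts" using starts_iff[OF k(1-3)] m t by simp
  qed
  have "bij_betw top A starts"
  proof (rule bij_betwI')
    fix x y assume "x \<in> A" "y \<in> A"
    then show "(top x = top y) = (x = y)"
      using tp by (cases x; cases y) (metis Suc_inject)
  next
    fix x assume "x \<in> A"
    then show "top x \<in> starts" using tp by (cases x) auto
  next
    fix b assume b: "b \<in> starts"
    then have "b \<in> support \<pi>" by (simp add: starts_def)
    then obtain d k v where k: "b = bx (Suc d) k" "d < r + c" "v < N" "1 \<le> k" 
      "C (Suc d) (Suc v) < int k" "int k \<le> C (Suc d) v" by (elim supportE)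
    have "mlt d v < C (Suc d) v - int k + 1"
      using starts_iff[OF k(4-6)] lev_bx[OF k(4-6)] b k(1) by simp
    then have "mlt d v < mlt (Suc d) v" "k = Suc (nat (C (Suc d) (Suc v)))"
      using mlt_Suc_le[of d v] k by auto
    then show "\<exists>x\<in>A. b = top x"
      using k by (intro bexI[of _ "(d, v)"]) (auto simp: A_def top_def)
  qed
  then have "pp_weight \<pi> = (\<Prod>x\<in>A. 1 - tvar ^ lev (top x))"
    unfolding pp_weight_starts by (subst prod.reindex_bij_betw[symmetric]) auto
  also have "\<dots> = (\<Prod>(d, v)\<in>A. hl_factor tvar (mlt d v) (mlt (Suc d) v))"
  proof (rule prod.cong[OF refl], clarify)
    fix d v assume dv: "(d, v) \<in> A"
    then have "nat (mlt (Suc d) v) = lev (top (d, v))" using tp(4)[OF dv] by simp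
    then show "1 - tvar ^ lev (top (d, v)) = hl_factor tvar (mlt d v) (mlt (Suc d) v)"
      using dv by (simp add: hl_factor_def A_def)
  qed
  also have "\<dots> = (\<Prod>(d, v)\<in>{..<r + c} \<times> {..<N}. hl_factor tvar (mlt d v) (mlt (Suc d) v))"
    by (rule prod.mono_neutral_left) (auto simp: A_def hl_factor_def split: if_splits)
  finally show ?thesis by (simp add: prod.cartesian_product)
qed

end

section \<open>Plane partitions as chains of diagonals\<close>

lemma fps_const_prod: "fps_const (\<Prod>x\<in>A. f x) = (\<Prod>x\<in>A. fps_const (f x :: 'a::comm_ring_1))"
  by (induction A rule: infinite_finite_induct) (auto simp flip: fps_const_mult)

lemma hl_factor_fps_const: "hl_factor (fps_const t) m m' = fps_const (hl_factor t m m')"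
  by (simp add: hl_factor_def fps_const_power flip: fps_const_sub)

text \<open>Summation by parts: the weight drops by one per step, so the weighted increments recover
  the plain sum up to boundary terms.\<close>

lemma sum_by_parts_descending:
  fixes f :: "nat \<Rightarrow> int"
  shows "(\<Sum>d<n. (int r - int d) * (f (Suc d) - f d)) = (int r - int n) * f n - int r * f 0 + (\<Sum>d<n. f (Suc d))"
  by (induction n) (simp_all add: algebra_simps)

context pp_diagonals begin

lemma pp_size_eq: "int (pp_size \<pi>) = (\<Sum>v<N. \<Sum>d<r + c. C (Suc d) v)"
proof -
  have "pp_size \<pi> = (\<Sum>b\<in>support \<pi>. \<Sum>v<N. of_bool (v < val b))"
    unfolding pp_size_def
  proof (rule sum.cong[OF refl])
    fix b :: box
    obtain i j where b: "b = (i, j)" by fastforce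
    have "{..<N} \<inter> {v. v < \<pi> i j} = {..<\<pi> i j}" using bound[of i j] by auto
    then show "val b = (\<Sum>v<N. of_bool (v < val b))" by (simp add: b)
  qed
  also have "\<dots> = (\<Sum>v<N. card {b \<in> support \<pi>. v < val b})"
    by (subst sum.swap) (simp add: finite_support Int_def)
  also have "\<dots> = (\<Sum>v<N. \<Sum>d<r + c. card {k. 1 \<le> k \<and> v < val (bx (Suc d) k)})"
  proof (rule sum.cong[OF refl])
    fix v
    let ?S = "SIGMA d:{..<r + c}. {k. 1 \<le> k \<and> v < val (bx (Suc d) k)}"
    have "bij_betw (\<lambda>(d, k). bx (Suc d) k) ?S {b \<in> support \<pi>. v < val b}"
    proof (rule bij_betwI')
      fix x y assume "x \<in> ?S" "y \<in> ?S"
      show "((\<lambda>(d, k). bx (Suc d) k) x = (\<lambda>(d, k). bx (Suc d) k) y) = (x = y)"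
      proof (cases x; cases y; safe)
        fix d k d' k' assume e: "bx (Suc d) k = bx (Suc d') k'"
        then have "d = d'" by (metis diag_bx Suc_inject)
        with e show "d = d'" "k = k'" by (auto simp: diag_box_def)
      qed
    next
      fix x assume "x \<in> ?S"
      then show "(\<lambda>(d, k). bx (Suc d) k) x \<in> {b \<in> support \<pi>. v < val b}"
        using bx_support by (cases x) auto
    next
      fix b assume b: "b \<in> {b \<in> support \<pi>. v < val b}"
      then obtain d k where "b = bx (Suc d) k" "d < r + c" "1 \<le> k"
        by (auto elim: supportE)
      then show "\<exists>x\<in>?S. b = (\<lambda>(d, k). bx (Suc d) k) x"
        using b by (intro bexI[of _ "(d, k)"]) auto
    qed
    then have "card {b \<in> support \<pi>. v < val b} = card ?S"
      by (simp add: bij_betw_same_card)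
    also have "\<dots> = (\<Sum>d<r + c. card {k. 1 \<le> k \<and> v < val (bx (Suc d) k)})"
    proof (rule card_SigmaI)
      have "{k. 1 \<le> k \<and> v < val (bx (Suc d) k)} \<subseteq> {..nat (C (Suc d) v)}" for d
        using galois by fastforce
      then show "\<forall>d\<in>{..<r + c}. finite {k. 1 \<le> k \<and> v < val (bx (Suc d) k)}"
        using finite_subset by blast
    qed simp
    finally show "card {b \<in> support \<pi>. v < val b} = (\<Sum>d<r + c. card {k. 1 \<le> k \<and> v < val (bx (Suc d) k)})" .
  qed
  finally show ?thesis by (simp add: diag_cols_def)
qed

text \<open>\<open>(r - d) + (d - r)\<close> is the distance of \<open>d\<close> from
  \<open>r\<close>. Columns grow before \<open>r\<close> and shrink after it, so the signed weight
  times the signed change has the right sign, and summation by parts applies. The boundary terms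
  vanish because diagonals 0 and \<open>r + c\<close> are empty.\<close>

lemma pp_size_by_parts:
  "pp_size \<pi> = (\<Sum>d<r + c. \<Sum>v<N. ((r - d) + (d - r)) * nat \<bar>C (Suc d) v - C d v\<bar>)"
proof -
  have "int (\<Sum>d<r + c. \<Sum>v<N. ((r - d) + (d - r)) * nat \<bar>C (Suc d) v - C d v\<bar>) =
    (\<Sum>d<r + c. \<Sum>v<N. (int r - int d) * (C (Suc d) v - C d v))"
    unfolding of_nat_sum
  proof (intro sum.cong refl)
    fix d v
    show "int (((r - d) + (d - r)) * nat \<bar>C (Suc d) v - C d v\<bar>) = (int r - int d) * (C (Suc d) v - C d v)"
    proof (cases "d < r")
      case True
      then show ?thesis using C_up[OF True, of v] by auto
    next
      case False
      then have *: "C d v - C (Suc d) v = 0 \<or> C d v - C (Suc d) v = 1" using C_down[of d v] by simp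
      then have "nat \<bar>C (Suc d) v - C d v\<bar> = nat (C d v - C (Suc d) v)" by auto
      then show ?thesis using False * by (auto simp: algebra_simps)
    qed
  qed
  also have "\<dots> = (\<Sum>v<N. \<Sum>d<r + c. (int r - int d) * (C (Suc d) v - C d v))"
    by (rule sum.swap)
  also have "\<dots> = (\<Sum>v<N. \<Sum>d<r + c. C (Suc d) v)"
    by (rule sum.cong[OF refl], subst sum_by_parts_descending) (simp add: C_zero_diag)
  finally show ?thesis using pp_size_eq by linarith
qed

lemma prod_hl_wt:
  "(\<Prod>d<r + c. hl_wt N ((r - d) + (d - r)) (C d) (C (Suc d))) = fps_const (pp_weight \<pi>) * fps_X ^ pp_size \<pi>"
  unfolding pp_weight_eq pp_size_by_parts
  by (simp add: hl_step_def prod.distrib fps_const_prod hl_factor_fps_const power_sum power_mult)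

end

section \<open>Bijection between plane partitions and chains\<close>

definition chain_set :: "nat \<Rightarrow> (bool \<times> nat) list \<Rightarrow> (nat \<Rightarrow> int) \<Rightarrow> (nat \<Rightarrow> nat \<Rightarrow> int) set" where
  "chain_set N ws \<alpha> = {D. D 0 = \<alpha> \<and> (\<forall>i<length ws. D (Suc i) \<in> moves N (fst (ws ! i)) (D i)) \<and>
     (\<forall>i\<ge>length ws. D i = (\<lambda>_. 0))}"

lemma chain_set_Nil: "chain_set N [] \<alpha> = (if \<alpha> = (\<lambda>_. 0) then {\<lambda>_ _. 0} else {})"
  by (auto simp: chain_set_def)

lemma bij_betw_chain_set_Cons:
  "bij_betw (\<lambda>(\<beta>, D). case_nat \<alpha> D) (SIGMA \<beta>:moves N b \<alpha>. chain_set N ws \<beta>) (chain_set N ((b, e) # ws) \<alpha>)"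
proof (rule bij_betw_byWitness[where f' = "\<lambda>D. (D 1, \<lambda>i. D (Suc i))"])
  show "\<forall>x\<in>SIGMA \<beta>:moves N b \<alpha>. chain_set N ws \<beta>.
      (\<lambda>D. (D 1, \<lambda>i. D (Suc i))) ((\<lambda>(\<beta>, D). case_nat \<alpha> D) x) = x"
    by (auto simp: chain_set_def)
  show "\<forall>D\<in>chain_set N ((b, e) # ws) \<alpha>. (\<lambda>(\<beta>, D). case_nat \<alpha> D) (D 1, \<lambda>i. D (Suc i)) = D"
    by (auto simp: chain_set_def fun_eq_iff split: nat.split)
  show "(\<lambda>(\<beta>, D). case_nat \<alpha> D) ` (SIGMA \<beta>:moves N b \<alpha>. chain_set N ws \<beta>) \<subseteq> chain_set N ((b, e) # ws) \<alpha>"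
    by (auto simp: chain_set_def nth_Cons split: nat.split)
  show "(\<lambda>D. (D 1, \<lambda>i. D (Suc i))) ` chain_set N ((b, e) # ws) \<alpha> \<subseteq> (SIGMA \<beta>:moves N b \<alpha>. chain_set N ws \<beta>)"
  proof safe
    fix D assume D: "D \<in> chain_set N ((b, e) # ws) \<alpha>"
    have s: "D (Suc i) \<in> moves N (fst (((b, e) # ws) ! i)) (D i)" if "i < Suc (length ws)" for i
      using D that by (simp add: chain_set_def)
    show "D 1 \<in> moves N b \<alpha>" using s[of 0] D by (simp add: chain_set_def)
    show "(\<lambda>i. D (Suc i)) \<in> chain_set N ws (D 1)"
      using s[of "Suc _"] D by (auto simp: chain_set_def)
  qed
qed

lemma finite_chain_set: "finite (chain_set N ws \<alpha>)"
proof (induction ws arbitrary: \<alpha>)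
  case (Cons w ws)
  show ?case
    using bij_betw_finite[OF bij_betw_chain_set_Cons[of \<alpha> N "fst w" ws "snd w"]]
    by (simp add: finite_moves Cons)
qed (simp add: chain_set_Nil)

lemma chain_sum_eq_sum:
  "chain_sum N ws \<alpha> = (\<Sum>D\<in>chain_set N ws \<alpha>. \<Prod>i<length ws. hl_wt N (snd (ws ! i)) (D i) (D (Suc i)))"
proof (induction ws arbitrary: \<alpha>)
  case (Cons w ws)
  obtain b e where w: "w = (b, e)" by fastforce
  have "(\<Sum>D\<in>chain_set N (w # ws) \<alpha>. \<Prod>i<length (w # ws). hl_wt N (snd ((w # ws) ! i)) (D i) (D (Suc i))) =
    (\<Sum>(\<beta>, D)\<in>(SIGMA \<beta>:moves N b \<alpha>. chain_set N ws \<beta>).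
       \<Prod>i<Suc (length ws). hl_wt N (snd ((w # ws) ! i)) (case_nat \<alpha> D i) (D i))"
    unfolding w by (subst sum.reindex_bij_betw[OF bij_betw_chain_set_Cons, symmetric]) (simp add: case_prod_unfold)
  also have "\<dots> = (\<Sum>\<beta>\<in>moves N b \<alpha>. \<Sum>D\<in>chain_set N ws \<beta>.
       \<Prod>i<Suc (length ws). hl_wt N (snd ((w # ws) ! i)) (case_nat \<alpha> D i) (D i))"
    by (subst sum.Sigma) (auto simp: finite_moves finite_chain_set)
  also have "\<dots> = (\<Sum>\<beta>\<in>moves N b \<alpha>. \<Sum>D\<in>chain_set N ws \<beta>. hl_wt N e \<alpha> \<beta> *
       (\<Prod>i<length ws. hl_wt N (snd (ws ! i)) (D i) (D (Suc i))))"
    unfolding prod.lessThan_Suc_shift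
    by (intro sum.cong refl) (simp add: w chain_set_def)
  finally show ?case by (simp add: w Cons.IH sum_distrib_left)
qed (simp add: chain_set_Nil)

text \<open>Weights \<open>r\<close> down to 1 for the steps up, then 0 to \<open>c - 1\<close> for
  the steps down: swapping weights \<open>i\<close> and \<open>j - 1\<close> yields the exponent
  \<open>i + j - 1\<close>.\<close>

definition rect_word :: "nat \<Rightarrow> nat \<Rightarrow> (bool \<times> nat) list" where
  "rect_word r c = map (Pair True) (map (\<lambda>d. r - d) [0..<r]) @ map (Pair False) [0..<c]"

lemma length_rect_word: "length (rect_word r c) = r + c"
  by (simp add: rect_word_def)

lemma nth_rect_word: "d < r + c \<Longrightarrow> rect_word r c ! d = (d < r, (r - d) + (d - r))"
  by (auto simp: rect_word_def nth_append)

lemma chain_set_rect_word: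
  "chain_set N (rect_word r c) \<alpha> = {D. D 0 = \<alpha> \<and> (\<forall>d<r + c. D (Suc d) \<in> moves N (d < r) (D d)) \<and>
     (\<forall>d\<ge>r + c. D d = (\<lambda>_. 0))}"
  unfolding chain_set_def length_rect_word by (auto simp: nth_rect_word)

lemma diag_cols_in_chain_set:
  assumes "\<pi> \<in> bounded_pps r c N"
  shows "diag_cols r \<pi> \<in> chain_set N (rect_word r c) (\<lambda>_. 0)"
proof -
  interpret pp_diagonals r c N \<pi> by unfold_locales fact
  show ?thesis unfolding chain_set_rect_word using C_moves C_zero_diag by (auto simp: fun_eq_iff)
qed

lemma box_eq_diag_box:
  assumes "1 \<le> i" "1 \<le> j" "i \<le> r + j"
  shows "(i, j) = diag_box r (j + r - i) (min i j)"
  using assms by (auto simp: diag_box_def min_def)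

lemma inj_on_diag_cols: "inj_on (diag_cols r) (bounded_pps r c N)"
proof (rule inj_onI)
  fix \<pi> \<rho> assume \<pi>: "\<pi> \<in> bounded_pps r c N" and \<rho>: "\<rho> \<in> bounded_pps r c N"
    and eq: "diag_cols r \<pi> = diag_cols r \<rho>"
  interpret A: pp_diagonals r c N \<pi> by unfold_locales fact
  interpret B: pp_diagonals r c N \<rho> by unfold_locales fact
  show "\<pi> = \<rho>"
  proof (intro ext)
    fix i j
    show "\<pi> i j = \<rho> i j"
    proof (cases "1 \<le> i \<and> 1 \<le> j \<and> i \<le> r")
      case True
      then have b: "(i, j) = diag_box r (j + r - i) (min i j)" by (intro box_eq_diag_box) auto
      have k: "1 \<le> min i j" using True by simp
      have "v < \<pi> i j \<longleftrightarrow> v < \<rho> i j" for v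
        using A.galois[OF k, of v "j + r - i"] B.galois[OF k, of v "j + r - i"] eq
        unfolding b[symmetric] by simp
      then show ?thesis by (meson linorder_neqE_nat less_irrefl)
    next
      case False
      then have "i = 0 \<or> j = 0 \<or> i > r" by auto
      then show ?thesis using A.zero_left B.zero_left A.outside B.outside by auto
    qed
  qed
qed

lemma card_initial_segment:
  fixes P :: "nat \<Rightarrow> bool"
  assumes "\<And>v. P (Suc v) \<Longrightarrow> P v" "\<And>v. P v \<Longrightarrow> v < N"
  shows "P v \<longleftrightarrow> v < card {v. P v}"
proof -
  have fin: "finite {v. P v}" by (rule finite_subset[of _ "{..<N}"]) (use assms in auto)
  have down: "P u" if "P v" "u \<le> v" for u v
    using that(2,1) by (induction rule: dec_induct) (use assms(1) in auto)
  show ?thesis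
  proof
    assume "P v"
    then have "{..v} \<subseteq> {v. P v}" using down by auto
    then have "card {..v} \<le> card {v. P v}" by (rule card_mono[OF fin])
    then show "v < card {v. P v}" by simp
  next
    assume v: "v < card {v. P v}"
    show "P v"
    proof (rule ccontr)
      assume "\<not> P v"
      then have "{v. P v} \<subseteq> {..<v}" using down by (auto simp: not_le[symmetric])
      then have "card {v. P v} \<le> card {..<v}" by (rule card_mono[rotated]) simp
      then show False using v by simp
    qed
  qed
qed

text \<open>Surjectivity: the entries are read off from the columns through the equivalence of
  \<open>galois\<close>. It remains to see that they form a plane partition and that no box falls
  outside the rectangle.\<close>

lemma chain_set_subset_image:
  assumes "D \<in> chain_set N (rect_word r c) (\<lambda>_. 0)"
  shows "\<exists>\<pi>\<in>bounded_pps r c N. D = diag_cols r \<pi>"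
proof -
  have D0: "D 0 v = 0" and Dend: "r + c \<le> d \<Longrightarrow> D d v = 0"
    and mv: "d < r + c \<Longrightarrow> D (Suc d) \<in> moves N (d < r) (D d)" for d v
    using assms by (simp_all add: chain_set_rect_word)
  have up: "D (Suc d) v - D d v \<in> {0, 1}" if "d < r" for d v
    using mv[of d] that by (simp add: moves_def up_cols_def)
  have dn: "D d v - D (Suc d) v \<in> {0, 1}" if "r \<le> d" for d v
  proof (cases "d < r + c")
    case True
    then show ?thesis using mv[of d] that by (simp add: moves_def dn_cols_def)
  qed (simp add: Dend)
  have cols: "D d \<in> cols N" for d
  proof (cases "d = 0 \<or> r + c \<le> d")
    case True
    then have "D d = (\<lambda>_. 0)" using D0 Dend by auto
    then show ?thesis by (simp add: zero_cols)
  next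
    case False
    then obtain e where "d = Suc e" "e < r + c" by (cases d) auto
    then show ?thesis using moves_cols[OF mv[of e]] by simp
  qed
  have nonneg: "0 \<le> D d v" for d v using cols_nonneg[OF cols] .
  \<comment> \<open>The three bounds come from the distance to the empty start, the distance to the
    empty end, and the peak at \<open>r\<close>. Together they keep every box encoded by
    \<open>D\<close> inside the rectangle.\<close>
  have b1: "D d v \<le> int d" for d v
  proof (induction d)
    case (Suc d)
    have "D (Suc d) v \<le> D d v + 1" using up[of d v] dn[of d v] by (cases "d < r") auto
    then show ?case using Suc by simp
  qed (simp add: D0)
  have b2: "D (r + c - m) v \<le> int m" for m v
  proof (induction m)
    case (Suc m)
    show ?case
    proof (cases "m < r + c")
      case True
      define d where "d = r + c - Suc m"
      have "r + c - m = Suc d" using True by (simp add: d_def)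
      moreover have "D d v \<le> D (Suc d) v + 1" using up[of d v] dn[of d v] by (cases "d < r") auto
      ultimately show ?thesis using Suc by (simp add: d_def)
    qed (simp add: D0)
  qed (simp add: Dend)
  have b3: "D d v \<le> D r v" for d v
  proof (cases "d \<le> r")
    case True
    then show ?thesis
    proof (induction d rule: inc_induct)
      case (step n)
      then show ?case using up[of n v] by auto
    qed simp
  next
    case False
    then have "r \<le> d" by simp
    then show ?thesis
    proof (induction d rule: dec_induct)
      case (step n)
      then show ?case using dn[of n v] by auto
    qed simp
  qed
  \<comment> \<open>The condition forced by \<open>galois\<close>: on diagonal
    \<open>j + r - i\<close>, position \<open>min i j\<close> has an entry above
    \<open>v\<close>.\<close>
  define P where "P i j v \<longleftrightarrow> 1 \<le> i \<and> 1 \<le> j \<and> i \<le> r \<and> j \<le> c \<and> int (min i j) \<le> D (j + r - i) v" for i j v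
  define \<pi> where "\<pi> i j = card {v. P i j v}" for i j
  have P: "v < \<pi> i j \<longleftrightarrow> P i j v" for i j v
    unfolding \<pi>_def
  proof (rule card_initial_segment[symmetric, of _ N])
    fix v assume "P i j (Suc v)"
    moreover have "D (j + r - i) (Suc v) \<le> D (j + r - i) v" using cols by (simp add: cols_def)
    ultimately show "P i j v" unfolding P_def by linarith
  next
    fix v assume "P i j v"
    show "v < N"
    proof (rule ccontr)
      assume "\<not> v < N"
      then have "D (j + r - i) v = 0" using cols by (simp add: cols_def)
      then show False using \<open>P i j v\<close> by (auto simp: P_def)
    qed
  qed
  have leI: "a \<le> b" if "\<And>v. v < a \<Longrightarrow> v < b" for a b :: nat
    using that[of b] by (meson less_irrefl not_le)
  have "\<pi> i (j + 1) \<le> \<pi> i j" if "1 \<le> i" "1 \<le> j" for i j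
  proof (rule leI)
    fix v assume "v < \<pi> i (j + 1)"
    then have p: "i \<le> r" "j < c" "int (min i (Suc j)) \<le> D (Suc (j + r - i)) v"
      using that unfolding P P_def by (auto simp: Suc_diff_le)
    \<comment> \<open>The box to the right lies on the next diagonal; the step there goes up exactly
      if \<open>j < i\<close>, which is also when \<open>min\<close> does not change.\<close>
    have "int (min i j) \<le> D (j + r - i) v"
    proof (cases "j < i")
      case True
      then have "j + r - i < r" using p(1) by simp
      then show ?thesis using up[of "j + r - i" v] p(3) True by auto
    next
      case False
      then have "r \<le> j + r - i" by simp
      then show ?thesis using dn[of "j + r - i" v] p(3) False by auto
    qed
    then show "v < \<pi> i j" using that p by (simp add: P P_def)
  qed
  moreover have "\<pi> (i + 1) j \<le> \<pi> i j" if "1 \<le> i" "1 \<le> j" for i j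
  proof (rule leI)
    fix v assume "v < \<pi> (i + 1) j"
    then have p: "i < r" "j \<le> c" "int (min (Suc i) j) \<le> D (j + r - Suc i) v"
      using that unfolding P P_def by auto
    define d where "d = j + r - Suc i"
    have d: "j + r - i = Suc d" using p(1) by (simp add: d_def)
    have "int (min i j) \<le> D (j + r - i) v"
    proof (cases "j \<le> i")
      case True
      then have "d < r" using p(1) that by (simp add: d_def)
      then show ?thesis using up[of d v] p(3) True unfolding d d_def[symmetric] by auto
    next
      case False
      then have "r \<le> d" using p(1) by (simp add: d_def)
      then show ?thesis using dn[of d v] p(3) False unfolding d d_def[symmetric] by auto
    qed
    then show "v < \<pi> i j" using that p by (simp add: P P_def)
  qed
  moreover have out: "\<pi> i j = 0" if "i = 0 \<or> j = 0 \<or> i > r \<or> j > c" for i j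
    unfolding \<pi>_def P_def using that by auto
  moreover have "\<pi> i j \<le> N" for i j
  proof (rule leI)
    fix v assume "v < \<pi> i j"
    then have "1 \<le> D (j + r - i) v" by (auto simp: P P_def)
    then show "v < N" using cols[of "j + r - i"] by (auto simp: cols_def not_less[symmetric])
  qed
  moreover have "finite (support \<pi>)"
  proof (rule finite_subset)
    show "support \<pi> \<subseteq> {..r} \<times> {..c}" using out by (force simp: support_def not_less[symmetric])
  qed simp
  ultimately have pp: "\<pi> \<in> bounded_pps r c N"
    by (simp add: bounded_pps_def plane_partitions_in_def plane_partitions_def)
  interpret pp_diagonals r c N \<pi> by unfold_locales fact
  have gal: "int k \<le> D d v \<longleftrightarrow> int k \<le> C d v" if k: "1 \<le> k" for d k v
  proof -
    obtain i j where ij: "diag_box r d k = (i, j)" by fastforce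
    have i: "i = k + (r - d)" "j = k + (d - r)" using ij by (auto simp: diag_box_def)
    have d: "j + r - i = d" "min i j = k" by (auto simp: i)
    have "int k \<le> C d v \<longleftrightarrow> P i j v"
      unfolding galois[OF k, symmetric] ij by (simp add: P)
    also have "\<dots> \<longleftrightarrow> int k \<le> D d v"
    proof
      assume kD: "int k \<le> D d v"
      have "D d v \<le> int r" "D d v \<le> int c"
        using b3[of d v] b1[of r v] b2[of c v] by simp_all
      moreover have "D d v \<le> int (r + c - d)" if "d \<le> r + c"
        using b2[of "r + c - d" v] that by simp
      moreover have "d \<le> r + c" using Dend[of d v] kD k by (cases "d \<le> r + c") auto
      ultimately have "i \<le> r \<and> j \<le> c" using b1[of d v] kD k unfolding i by linarith
      then show "P i j v" using kD k d by (simp add: P_def i)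
    qed (use d in \<open>simp add: P_def\<close>)
    finally show ?thesis by simp
  qed
  have "D d v = C d v" for d v
  proof (rule antisym)
    show "D d v \<le> C d v"
      using gal[of "nat (D d v)" d v] nonneg[of d v] C_nonneg[of d v] by (cases "D d v = 0") auto
    show "C d v \<le> D d v"
      using gal[of "nat (C d v)" d v] nonneg[of d v] C_nonneg[of d v] by (cases "C d v = 0") auto
  qed
  then have "D = C" by (simp add: fun_eq_iff)
  then show ?thesis using pp by blast
qed

theorem bij_betw_diag_cols:
  "bij_betw (diag_cols r) (bounded_pps r c N) (chain_set N (rect_word r c) (\<lambda>_. 0))"
  unfolding bij_betw_def
  using inj_on_diag_cols diag_cols_in_chain_set chain_set_subset_image by blast

lemma chain_sum_rect_word:
  "chain_sum N (rect_word r c) (\<lambda>_. 0) = (\<Sum>\<pi>\<in>bounded_pps r c N. fps_const (pp_weight \<pi>) * fps_X ^ pp_size \<pi>)"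
proof -
  have "chain_sum N (rect_word r c) (\<lambda>_. 0) = (\<Sum>\<pi>\<in>bounded_pps r c N.
     \<Prod>d<r + c. hl_wt N (snd (rect_word r c ! d)) (diag_cols r \<pi> d) (diag_cols r \<pi> (Suc d)))"
    unfolding chain_sum_eq_sum length_rect_word
    by (subst sum.reindex_bij_betw[OF bij_betw_diag_cols, symmetric]) simp
  also have "\<dots> = (\<Sum>\<pi>\<in>bounded_pps r c N. fps_const (pp_weight \<pi>) * fps_X ^ pp_size \<pi>)"
  proof (rule sum.cong[OF refl])
    fix \<pi> assume "\<pi> \<in> bounded_pps r c N"
    then interpret pp_diagonals r c N \<pi> by unfold_locales
    show "(\<Prod>d<r + c. hl_wt N (snd (rect_word r c ! d)) (C d) (C (Suc d))) =
      fps_const (pp_weight \<pi>) * fps_X ^ pp_size \<pi>"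
      unfolding prod_hl_wt[symmetric] by (rule prod.cong) (auto simp: nth_rect_word)
  qed
  finally show ?thesis .
qed

section \<open>Generating functions\<close>

text \<open>Convergence is coefficientwise, and a finite subset containing all elements of degree
  \<open>n\<close> already has the final \<open>n\<close>-th coefficient.\<close>

lemma has_sum_graded_fps:
  fixes w :: "'b \<Rightarrow> 'a::comm_ring_1"
  assumes "\<And>n. finite {x \<in> A. deg x = n}"
    and "\<And>n. fps_nth S n = (\<Sum>x | x \<in> A \<and> deg x = n. w x)"
  shows "((\<lambda>x. fps_const (w x) * fps_X ^ deg x) has_sum S) A"
  unfolding has_sum_def
proof (rule tendsto_fpsI)
  fix n
  show "\<forall>\<^sub>F F in finite_subsets_at_top A. fps_nth (\<Sum>x\<in>F. fps_const (w x) * fps_X ^ deg x) n = fps_nth S n"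
    unfolding eventually_finite_subsets_at_top
  proof (intro exI[of _ "{x \<in> A. deg x = n}"] conjI allI impI)
    fix F assume F: "finite F \<and> {x \<in> A. deg x = n} \<subseteq> F \<and> F \<subseteq> A"
    then have "{x \<in> F. deg x = n} = {x \<in> A. deg x = n}" by auto
    moreover have "fps_nth (\<Sum>x\<in>F. fps_const (w x) * fps_X ^ deg x) n = (\<Sum>x\<in>F. if deg x = n then w x else 0)"
      unfolding fps_sum_nth by (intro sum.cong refl) (auto simp: fps_X_power_iff)
    ultimately show "fps_nth (\<Sum>x\<in>F. fps_const (w x) * fps_X ^ deg x) n = fps_nth S n"
      using F assms(2)[of n] by (simp flip: sum.inter_filter)
  qed (use assms(1) in auto)
qed

lemma fps_nth_eq_if_dvd:
  fixes f g :: "'a::comm_ring_1 fps"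
  assumes "fps_X ^ Suc n dvd f - g" "k \<le> n"
  shows "fps_nth f k = fps_nth g k"
proof -
  obtain h where h: "f - g = fps_X ^ Suc n * h" using assms(1) by (elim dvdE)
  have "fps_nth (f - g) k = 0" unfolding h fps_X_power_mult_nth using assms(2) by simp
  then show ?thesis by simp
qed

lemma dvd_prod_diff:
  fixes f g :: "'b \<Rightarrow> 'a::comm_ring_1"
  assumes "\<And>x. x \<in> A \<Longrightarrow> m dvd f x - g x"
  shows "m dvd (\<Prod>x\<in>A. f x) - (\<Prod>x\<in>A. g x)"
  using assms
proof (induction A rule: infinite_finite_induct)
  case (insert x A)
  have "(\<Prod>x\<in>insert x A. f x) - (\<Prod>x\<in>insert x A. g x) =
     (f x - g x) * (\<Prod>x\<in>A. f x) + g x * ((\<Prod>x\<in>A. f x) - (\<Prod>x\<in>A. g x))"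
    using insert.hyps by (simp add: algebra_simps)
  then show ?case using insert by (simp add: dvd_add dvd_mult dvd_mult2)
qed auto

lemma macmahon_factor_dvd: "k \<ge> 1 \<Longrightarrow> fps_X ^ k dvd macmahon_factor k - 1"
proof
  assume "k \<ge> 1"
  show "macmahon_factor k - 1 = fps_X ^ k * (macmahon_factor k - fps_const tvar)"
    using macmahon_factor_mult[OF \<open>k \<ge> 1\<close>] by (simp add: algebra_simps)
qed

section \<open>Size bounds, coefficients and truncated products\<close>

lemma entry_le_pp_size:
  assumes "\<pi> \<in> plane_partitions" shows "\<pi> i j \<le> pp_size \<pi>"
proof (cases "(i, j) \<in> support \<pi>")
  case True
  then show ?thesis
    unfolding pp_size_def using assms member_le_sum[of "(i, j)" "support \<pi>" "\<lambda>(i, j). \<pi> i j"]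
    by (simp add: plane_partitions_def)
next
  case False
  then have "\<pi> i j = 0"
    using assms by (auto simp: support_def plane_partitions_def not_less_eq_eq)
  then show ?thesis by simp
qed

lemma card_support_le_pp_size:
  assumes "\<pi> \<in> plane_partitions" "A \<subseteq> support \<pi>" shows "card A \<le> pp_size \<pi>"
proof -
  have fin: "finite (support \<pi>)" using assms by (simp add: plane_partitions_def)
  have "card A = (\<Sum>_\<in>A. 1)" by simp
  also have "\<dots> \<le> (\<Sum>(i, j)\<in>A. \<pi> i j)"
    using assms(2) by (intro sum_mono) (auto simp: support_def)
  also have "\<dots> \<le> pp_size \<pi>"
    unfolding pp_size_def by (rule sum_mono2[OF fin assms(2)]) auto
  finally show ?thesis .
qed

text \<open>A nonzero entry at \<open>(i, j)\<close> makes the first \<open>i\<close> boxes of its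
  column and the first \<open>j\<close> boxes of its row nonzero, so the size is at least
  \<open>i\<close> and at least \<open>j\<close>.\<close>

lemma plane_partition_vanishes:
  assumes "\<pi> \<in> plane_partitions" "i > pp_size \<pi> \<or> j > pp_size \<pi>"
  shows "\<pi> i j = 0"
proof (rule ccontr)
  assume nz: "\<pi> i j \<noteq> 0"
  have z: "i = 0 \<or> j = 0 \<Longrightarrow> \<pi> i j = 0"
    and right: "1 \<le> i \<Longrightarrow> 1 \<le> j \<Longrightarrow> \<pi> i (Suc j) \<le> \<pi> i j"
    and down: "1 \<le> i \<Longrightarrow> 1 \<le> j \<Longrightarrow> \<pi> (Suc i) j \<le> \<pi> i j" for i j
    using assms(1) by (auto simp: plane_partitions_def)
  have "i \<noteq> 0 \<and> j \<noteq> 0" using z[of i j] nz by metis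
  then have ij: "1 \<le> i" "1 \<le> j" by simp_all
  have row: "\<pi> a j \<ge> \<pi> i j" if "1 \<le> a" "a \<le> i" for a
    using that(2,1)
  proof (induction rule: inc_induct)
    case (step n)
    then show ?case using down[of n j] ij by simp
  qed simp
  have col: "\<pi> i b \<ge> \<pi> i j" if "1 \<le> b" "b \<le> j" for b
    using that(2,1)
  proof (induction rule: inc_induct)
    case (step n)
    then show ?case using right[of i n] ij by simp
  qed simp
  have "card ((\<lambda>a. (a, j)) ` {1..i}) \<le> pp_size \<pi>"
    using row nz ij(2) by (intro card_support_le_pp_size[OF assms(1)]) (force simp: support_def)
  moreover have "card ((\<lambda>b. (i, b)) ` {1..j}) \<le> pp_size \<pi>"
    using col nz ij(1) by (intro card_support_le_pp_size[OF assms(1)]) (force simp: support_def)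
  ultimately show False using assms(2) by (simp add: card_image inj_on_def)
qed

lemma prod_list_map_upt: "(\<Prod>i\<leftarrow>[0..<n]. f i) = (\<Prod>i<n. f i :: 'a::comm_monoid_mult)"
  by (induction n) simp_all

lemma rectangle_prod_eq:
  "(\<Prod>f\<leftarrow>[0..<c]. \<Prod>e\<leftarrow>map (\<lambda>d. r - d) [0..<r]. macmahon_factor (e + f)) =
   (\<Prod>i=1..r. \<Prod>j=1..c. macmahon_factor (i + j - 1))"
proof -
  have list: "(\<Prod>e\<leftarrow>map (\<lambda>d. r - d) [0..<r]. g e) = (\<Prod>i=1..r. g i)" for g :: "nat \<Rightarrow> int poly fps"
  proof -
    have "(\<Prod>e\<leftarrow>map (\<lambda>d. r - d) [0..<r]. g e) = (\<Prod>d<r. g (r - d))"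
      by (simp add: comp_def prod_list_map_upt)
    also have "\<dots> = (\<Prod>d<r. g (Suc (r - Suc d)))"
      by (intro prod.cong) (auto simp: Suc_diff_Suc)
    also have "\<dots> = (\<Prod>d<r. g (Suc d))"
      by (rule prod.nat_diff_reindex)
    finally show ?thesis by (simp add: prod.atLeast1_atMost_eq)
  qed
  have "(\<Prod>f\<leftarrow>[0..<c]. \<Prod>e\<leftarrow>map (\<lambda>d. r - d) [0..<r]. macmahon_factor (e + f)) =
    (\<Prod>f<c. \<Prod>i=1..r. macmahon_factor (i + f))"
    unfolding list prod_list_map_upt by (rule refl)
  also have "\<dots> = (\<Prod>j=1..c. \<Prod>i=1..r. macmahon_factor (i + j - 1))"
    by (simp add: prod.atLeast1_atMost_eq)
  finally show ?thesis by (subst prod.swap)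
qed

text \<open>Entries never exceed the size, so the bound \<open>n\<close> on entries loses nothing in
  degree \<open>n\<close>, and the truncation error begins only in degree
  \<open>n + 1\<close>.\<close>

lemma plane_partitions_in_coeff:
  shows "finite {\<pi> \<in> plane_partitions_in r c. pp_size \<pi> = n}"
    and "fps_nth (\<Prod>i=1..r. \<Prod>j=1..c. macmahon_factor (i + j - 1)) n =
      (\<Sum>\<pi> | \<pi> \<in> plane_partitions_in r c \<and> pp_size \<pi> = n. pp_weight \<pi>)"
proof -
  have eq: "{\<pi> \<in> plane_partitions_in r c. pp_size \<pi> = n} = {\<pi> \<in> bounded_pps r c n. pp_size \<pi> = n}"
    using entry_le_pp_size by (auto simp: bounded_pps_def plane_partitions_in_def)
  have fin: "finite (bounded_pps r c n)"
    using bij_betw_finite[OF bij_betw_diag_cols] finite_chain_set by blast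
  show "finite {\<pi> \<in> plane_partitions_in r c. pp_size \<pi> = n}"
    unfolding eq using fin by simp
  have "fps_X ^ Suc n dvd chain_sum n (rect_word r c) (\<lambda>_. 0) -
     (\<Prod>f\<leftarrow>[0..<c]. \<Prod>e\<leftarrow>map (\<lambda>d. r - d) [0..<r]. macmahon_factor (e + f))"
    unfolding rect_word_def by (rule chain_sum_rectangle) auto
  then have "fps_nth (chain_sum n (rect_word r c) (\<lambda>_. 0)) n = fps_nth (\<Prod>i=1..r. \<Prod>j=1..c. macmahon_factor (i + j - 1)) n"
    unfolding rectangle_prod_eq by (rule fps_nth_eq_if_dvd) simp
  moreover have "fps_nth (chain_sum n (rect_word r c) (\<lambda>_. 0)) n =
      (\<Sum>\<pi>\<in>bounded_pps r c n. if pp_size \<pi> = n then pp_weight \<pi> else 0)"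
    unfolding chain_sum_rect_word fps_sum_nth by (intro sum.cong refl) (auto simp: fps_X_power_iff)
  ultimately show "fps_nth (\<Prod>i=1..r. \<Prod>j=1..c. macmahon_factor (i + j - 1)) n =
      (\<Sum>\<pi> | \<pi> \<in> plane_partitions_in r c \<and> pp_size \<pi> = n. pp_weight \<pi>)"
    unfolding eq using fin by (simp add: sum.inter_filter)
qed

text \<open>An exponent \<open>k \<le> M\<close> arises as \<open>i + j - 1\<close> from exactly
  \<open>k\<close> boxes of the square; factors with larger exponent are 1 modulo
  \<open>fps_X ^ Suc M\<close>.\<close>

lemma square_prod_trunc:
  "fps_X ^ Suc M dvd (\<Prod>i=1..M. \<Prod>j=1..M. macmahon_factor (i + j - 1)) - (\<Prod>k=1..M. macmahon_factor k ^ k)"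
proof -
  define A where "A = {1..M} \<times> {1..M}"
  define s where "s = (\<lambda>(i, j). i + j - 1 :: nat)"
  have "(\<Prod>i=1..M. \<Prod>j=1..M. macmahon_factor (i + j - 1)) = (\<Prod>x\<in>A. macmahon_factor (s x))"
    by (simp add: prod.cartesian_product A_def s_def case_prod_unfold)
  moreover have "(\<Prod>k=1..M. macmahon_factor k ^ k) = (\<Prod>x\<in>A. if s x \<le> M then macmahon_factor (s x) else 1)"
  proof -
    have "(\<Prod>x\<in>A. if s x \<le> M then macmahon_factor (s x) else 1) = (\<Prod>x | x \<in> A \<and> s x \<le> M. macmahon_factor (s x))"
      by (simp add: prod.inter_filter A_def)
    also have "\<dots> = (\<Prod>k=1..M. \<Prod>x | x \<in> {x \<in> A. s x \<le> M} \<and> s x = k. macmahon_factor (s x))"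
      by (rule prod.group[symmetric]) (auto simp: A_def s_def)
    also have "\<dots> = (\<Prod>k=1..M. macmahon_factor k ^ k)"
    proof (rule prod.cong[OF refl])
      fix k assume k: "k \<in> {1..M}"
      have "{x. x \<in> {x \<in> A. s x \<le> M} \<and> s x = k} = (\<lambda>i. (i, Suc k - i)) ` {1..k}"
      proof (intro equalityI subsetI)
        fix x assume "x \<in> {x. x \<in> {x \<in> A. s x \<le> M} \<and> s x = k}"
        then show "x \<in> (\<lambda>i. (i, Suc k - i)) ` {1..k}"
          by (intro image_eqI[of _ _ "fst x"]) (auto simp: A_def s_def)
      qed (use k in \<open>auto simp: A_def s_def\<close>)
      then have card: "card {x. x \<in> {x \<in> A. s x \<le> M} \<and> s x = k} = k"
        by (simp add: card_image inj_on_def)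
      have "(\<Prod>x | x \<in> {x \<in> A. s x \<le> M} \<and> s x = k. macmahon_factor (s x)) =
         (\<Prod>x | x \<in> {x \<in> A. s x \<le> M} \<and> s x = k. macmahon_factor k)"
        by (rule prod.cong) auto
      then show "(\<Prod>x | x \<in> {x \<in> A. s x \<le> M} \<and> s x = k. macmahon_factor (s x)) = macmahon_factor k ^ k"
        unfolding prod_constant card .
    qed
    finally show ?thesis by simp
  qed
  moreover have "fps_X ^ Suc M dvd (\<Prod>x\<in>A. macmahon_factor (s x)) -
      (\<Prod>x\<in>A. if s x \<le> M then macmahon_factor (s x) else 1)"
  proof (rule dvd_prod_diff)
    fix x assume "x \<in> A"
    show "fps_X ^ Suc M dvd macmahon_factor (s x) - (if s x \<le> M then macmahon_factor (s x) else 1)"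
    proof (cases "s x \<le> M")
      case False
      then have "fps_X ^ Suc M dvd (fps_X ^ s x :: int poly fps)" by (intro le_imp_power_dvd) simp
      also have "\<dots> dvd macmahon_factor (s x) - 1" using False by (intro macmahon_factor_dvd) simp
      finally show ?thesis using False by simp
    qed simp
  qed
  ultimately show ?thesis by simp
qed

text \<open>The factor of index \<open>k\<close> is 1 modulo \<open>fps_X ^ k\<close>, so it cannot
  affect coefficients below degree \<open>k\<close>.\<close>

lemma partial_prod_stable:
  assumes "n \<le> M"
  shows "fps_nth (\<Prod>k=1..Suc M. macmahon_factor k ^ k) n = fps_nth (\<Prod>k=1..Suc n. macmahon_factor k ^ k) n"
  using assms
proof (induction M rule: dec_induct)
  case (step M)
  have "fps_X ^ Suc n dvd (fps_X ^ Suc (Suc M) :: int poly fps)"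
    using step by (intro le_imp_power_dvd) simp
  also have "\<dots> dvd macmahon_factor (Suc (Suc M)) - 1" by (rule macmahon_factor_dvd) simp
  finally have "fps_X ^ Suc n dvd (\<Prod>i<Suc (Suc M). macmahon_factor (Suc (Suc M))) - (\<Prod>i<Suc (Suc M). 1)"
    by (intro dvd_prod_diff)
  then have "fps_X ^ Suc n dvd macmahon_factor (Suc (Suc M)) ^ Suc (Suc M) - 1" by simp
  then have "fps_X ^ Suc n dvd (\<Prod>k=1..Suc M. macmahon_factor k ^ k) *
      (macmahon_factor (Suc (Suc M)) ^ Suc (Suc M) - 1)" by (rule dvd_mult)
  also have "\<dots> = (\<Prod>k=1..Suc (Suc M). macmahon_factor k ^ k) - (\<Prod>k=1..Suc M. macmahon_factor k ^ k)"
    by (simp add: algebra_simps)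
  finally have "fps_nth (\<Prod>k=1..Suc (Suc M). macmahon_factor k ^ k) n = fps_nth (\<Prod>k=1..Suc M. macmahon_factor k ^ k) n"
    by (rule fps_nth_eq_if_dvd) simp
  from this step.IH show ?case by (rule trans)
qed simp

theorem theoremB:
  shows "(\<forall>r\<ge>1. \<forall>c\<ge>1.
            ((\<lambda>\<pi>. fps_const (pp_weight \<pi>) * fps_X ^ pp_size \<pi>) has_sum
              (\<Prod>i=1..r. \<Prod>j=1..c. macmahon_factor (i + j - 1))) (plane_partitions_in r c))
       \<and> convergent_prod (\<lambda>n. macmahon_factor (Suc n) ^ Suc n)
       \<and> ((\<lambda>\<pi>. fps_const (pp_weight \<pi>) * fps_X ^ pp_size \<pi>) has_sum
            (\<Prod>n. macmahon_factor (Suc n) ^ Suc n)) plane_partitions"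
proof (intro conjI allI impI)
  fix r c :: nat
  show "((\<lambda>\<pi>. fps_const (pp_weight \<pi>) * fps_X ^ pp_size \<pi>) has_sum
          (\<Prod>i=1..r. \<Prod>j=1..c. macmahon_factor (i + j - 1))) (plane_partitions_in r c)"
    by (rule has_sum_graded_fps) (rule plane_partitions_in_coeff)+
next
  define Q where "Q n = (\<Prod>k=1..Suc n. macmahon_factor k ^ k)" for n
  \<comment> \<open>The \<open>n\<close>-th coefficient is stable from \<open>Q n\<close> on, so the
    limit is read off diagonally.\<close>
  define L where "L = Abs_fps (\<lambda>n. fps_nth (Q n) n)"
  have "(\<lambda>n. \<Prod>i\<le>n. macmahon_factor (Suc (i + 0)) ^ Suc (i + 0)) = Q"
    by (simp add: Q_def prod.atLeast1_atMost_eq lessThan_Suc_atMost fun_eq_iff del: prod.cl_ivl_Suc)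
  moreover have "Q \<longlonglongrightarrow> L"
  proof (rule tendsto_fpsI)
    fix n
    show "\<forall>\<^sub>F M in sequentially. fps_nth (Q M) n = fps_nth L n"
      using eventually_ge_at_top[of n]
      by eventually_elim (unfold Q_def L_def fps_nth_Abs_fps, rule partial_prod_stable)
  qed
  \<comment> \<open>\<open>raw_has_prod\<close> demands a nonzero limit, which the constant term 1
    provides.\<close>
  moreover have "fps_nth L 0 = 1"
  proof -
    have "fps_X ^ Suc 0 dvd macmahon_factor 1 - 1" using macmahon_factor_dvd[of 1] by simp
    then have "fps_nth (macmahon_factor 1) 0 = fps_nth 1 0" by (rule fps_nth_eq_if_dvd) simp
    then show ?thesis by (simp add: L_def Q_def)
  qed
  then have "L \<noteq> 0" by auto
  ultimately have raw: "raw_has_prod (\<lambda>n. macmahon_factor (Suc n) ^ Suc n) 0 L"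
    by (simp add: raw_has_prod_def)
  then show "convergent_prod (\<lambda>n. macmahon_factor (Suc n) ^ Suc n)"
    unfolding convergent_prod_def by blast
  have "(\<lambda>n. macmahon_factor (Suc n) ^ Suc n) has_prod L"
    using raw by (simp add: has_prod_def)
  then have L: "(\<Prod>n. macmahon_factor (Suc n) ^ Suc n) = L"
    by (rule has_prod_unique[symmetric])
  \<comment> \<open>Size \<open>n\<close> confines the support to a square of side \<open>n\<close>;
    the side \<open>Suc n\<close> is chosen to match the partial product \<open>Q n\<close>.\<close>
  have eq: "{\<pi> \<in> plane_partitions. pp_size \<pi> = n} = {\<pi> \<in> plane_partitions_in (Suc n) (Suc n). pp_size \<pi> = n}" for n
    using plane_partition_vanishes by (auto simp: plane_partitions_in_def)
  show "((\<lambda>\<pi>. fps_const (pp_weight \<pi>) * fps_X ^ pp_size \<pi>) has_sum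
      (\<Prod>n. macmahon_factor (Suc n) ^ Suc n)) plane_partitions"
    unfolding L
  proof (rule has_sum_graded_fps)
    fix n
    show "finite {\<pi> \<in> plane_partitions. pp_size \<pi> = n}"
      unfolding eq by (rule plane_partitions_in_coeff)
    have "fps_nth L n = fps_nth (\<Prod>i=1..Suc n. \<Prod>j=1..Suc n. macmahon_factor (i + j - 1)) n"
      unfolding L_def Q_def fps_nth_Abs_fps
      by (rule fps_nth_eq_if_dvd[OF square_prod_trunc, symmetric]) simp
    also have "\<dots> = (\<Sum>\<pi> | \<pi> \<in> plane_partitions_in (Suc n) (Suc n) \<and> pp_size \<pi> = n. pp_weight \<pi>)"
      by (rule plane_partitions_in_coeff)
    finally show "fps_nth L n = (\<Sum>\<pi> | \<pi> \<in> plane_partitions \<and> pp_size \<pi> = n. pp_weight \<pi>)"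
      unfolding eq .
  qed
qed

end
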